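(* Assume the following two conjectures. (Conjecture A.) Let $\pi\colon X\to\mathbb{P}^1$ be an elliptic surface defined over $\mathbb{Q}$ and fix an affine chart $\mathbb{A}^1\subseteq\mathbb{P}^1$ with affine coordinate $t$. Suppose $\pi$ has a fibre of multiplicative type over some point of $\mathbb{A}^1$. Let $N(x)$ be the number of integers $1\le n\le x$ such that the fibre $X_n$ at $t=n$ is an elliptic curve with $\mathrm{rank}\,X_n(\mathbb{Q})>0$. Then there is $c>0$ with $N(x)\ge cx$ for all sufficiently large $x$. (Conjecture C.) There is an elliptic surface $\pi\colon X\to\mathbb{P}^1$ defined over $\mathbb{Q}$ such that (i) $\pi$ has a fibre of multiplicative type (over a point of $\mathbb{P}^1(\mathbb{C})$), and (ii) $X$ contains at most finitely many (possibly singular) rational curves defined over $\mathbb{C}$. Then $\mathbb{Q}$ is Diophantine in $\mathbb{Q}(z)$, where $z$ is transcendental over $\mathbb{Q}$.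
   Context: A set $S\subseteq A^m$ (for a ring $A$) is Diophantine over $A$ if there are polynomials $F_1,\dots,F_r\in A[x_1,\dots,x_m,y_1,\dots,y_n]$ such that $\mathbf{a}\in S$ iff the equations $F_j(\mathbf{a},\mathbf{y})=0$ have a common solution $\mathbf{y}\in A^n$. An elliptic surface over a field $k$ of characteristic $0$ is a morphism $\pi\colon X\to\mathbb{P}^1$ with a section $\sigma_0$, both over $k$, $X$ smooth projective, generic fibre an elliptic curve with origin $\sigma_0$, and $\pi$ relatively minimal. A fibre of multiplicative type is a singular fibre of Kodaira type $I_n$ ($n\ge1$). *)

theory Defs
  imports
    "HOL-Library.Poly_Mapping"
    "HOL-Library.Function_Algebras"
    "HOL-Library.Extended_Nat"
    "HOL-Computational_Algebra.Polynomial"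
    "HOL-Computational_Algebra.Fraction_Field"
    "HOL-Algebra.FiniteProduct"
    "HOL-Analysis.Derivative"
begin

section \<open>Multivariate polynomials\<close>

text \<open>Polynomials in variables \<open>x\<^sub>0, x\<^sub>1, \<dots>\<close>: finitely supported maps from exponent vectors
  to coefficients, with the ring structure of \<open>Poly_Mapping\<close>.\<close>

type_synonym 'a mpoly = "(nat \<Rightarrow>\<^sub>0 nat) \<Rightarrow>\<^sub>0 'a"

definition mpoly_eval :: "(nat \<Rightarrow> 'a::comm_semiring_1) \<Rightarrow> 'a mpoly \<Rightarrow> 'a" where
  "mpoly_eval v F =
     (\<Sum>e\<in>Poly_Mapping.keys F. Poly_Mapping.lookup F e *
        (\<Prod>i\<in>Poly_Mapping.keys e. v i ^ Poly_Mapping.lookup e i))"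

definition mpoly_vars :: "'a::zero mpoly \<Rightarrow> nat set" where
  "mpoly_vars F = (\<Union>e\<in>Poly_Mapping.keys F. Poly_Mapping.keys e)"

definition homogeneous :: "nat \<Rightarrow> 'a::zero mpoly \<Rightarrow> bool" where
  "homogeneous d F \<longleftrightarrow>
     (\<forall>e\<in>Poly_Mapping.keys F. (\<Sum>i\<in>Poly_Mapping.keys e. Poly_Mapping.lookup e i) = d)"

definition has_coeffs_in :: "'a::zero set \<Rightarrow> 'a mpoly \<Rightarrow> bool" where
  "has_coeffs_in k F \<longleftrightarrow> (\<forall>e. Poly_Mapping.lookup F e \<in> k)"

section \<open>Diophantine sets\<close>

text \<open>The ring \<open>A\<close> is the type \<open>'a\<close>, and \<open>A\<^sup>m\<close> is the set of lists of length \<open>m\<close>.  The variables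
  \<open>x\<^sub>1, \<dots>, x\<^sub>m, y\<^sub>1, \<dots>, y\<^sub>n\<close> are numbered from \<open>0\<close> to \<open>m + n - 1\<close>.\<close>

definition diophantine :: "nat \<Rightarrow> 'a::comm_ring_1 list set \<Rightarrow> bool" where
  "diophantine m S \<longleftrightarrow> S \<subseteq> {a. length a = m} \<and>
     (\<exists>n (\<F> :: 'a mpoly set). finite \<F> \<and> (\<forall>F\<in>\<F>. mpoly_vars F \<subseteq> {..<m + n}) \<and>
        (\<forall>a. length a = m \<longrightarrow>
           (a \<in> S \<longleftrightarrow> (\<exists>y. length y = n \<and> (\<forall>F\<in>\<F>. mpoly_eval (\<lambda>i. (a @ y) ! i) F = 0)))))"

text \<open>The constants \<open>\<rat>\<close> inside the field \<open>\<rat>(z)\<close> of rational functions, as a subset of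
  \<open>\<rat>(z)\<^sup>1\<close>; the transcendental \<open>z\<close> is \<open>Fract [:0, 1:] 1\<close>.\<close>

definition rat_constants :: "rat poly fract list set" where
  "rat_constants = {[Fract [:q:] 1] | q. True}"

section \<open>Projective varieties over subfields of the complex numbers\<close>

text \<open>Varieties over a subfield \<open>k\<close> of \<open>\<complex>\<close> are identified with their sets of complex points,
  all structure (equations, morphisms) being given by polynomials with coefficients in \<open>k\<close>.
  A point of \<open>\<P>\<^sup>N\<close> is the class of its homogeneous coordinate vectors, and a vector of
  \<open>\<complex>\<^sup>N\<^sup>+\<^sup>1\<close> is a function vanishing at all indices above \<open>N\<close>.\<close>

type_synonym point = "(nat \<Rightarrow> complex) set"

definition cvec :: "nat \<Rightarrow> (nat \<Rightarrow> complex) set" where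
  "cvec N = {v. \<forall>i>N. v i = 0}"

definition proj_pt :: "(nat \<Rightarrow> complex) \<Rightarrow> point" where
  "proj_pt v = {(\<lambda>i. c * v i) | c. c \<noteq> 0}"

definition proj_space :: "nat \<Rightarrow> point set" where
  "proj_space N = proj_pt ` {v \<in> cvec N. \<exists>i. v i \<noteq> 0}"

definition rational_points :: "complex set \<Rightarrow> point set \<Rightarrow> point set" where
  "rational_points k X = {P \<in> X. \<exists>v\<in>P. \<forall>i. v i \<in> k}"

definition proj_closed :: "complex set \<Rightarrow> nat \<Rightarrow> point set \<Rightarrow> bool" where
  "proj_closed k N X \<longleftrightarrow>
     (\<exists>S. finite S \<and> (\<forall>F\<in>S. has_coeffs_in k F \<and> (\<exists>d. homogeneous d F)) \<and>
          X = {P \<in> proj_space N. \<forall>F\<in>S. \<forall>v\<in>P. mpoly_eval v F = 0})"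

definition open_subset :: "complex set \<Rightarrow> nat \<Rightarrow> point set \<Rightarrow> point set \<Rightarrow> bool" where
  "open_subset k N X U \<longleftrightarrow> (\<exists>Z. proj_closed k N Z \<and> U = X - Z)"

text \<open>Irreducibility is over \<open>\<complex>\<close>, that is, geometric irreducibility.\<close>

definition irreducible_set :: "nat \<Rightarrow> point set \<Rightarrow> bool" where
  "irreducible_set N X \<longleftrightarrow> X \<noteq> {} \<and>
     (\<forall>Z W. proj_closed UNIV N Z \<longrightarrow> proj_closed UNIV N W \<longrightarrow> X \<subseteq> Z \<union> W \<longrightarrow> X \<subseteq> Z \<or> X \<subseteq> W)"

text \<open>Membership in the ideal of the affine cone over \<open>X\<close>; not only homogeneous polynomials.\<close>

definition vanishes_on :: "point set \<Rightarrow> complex mpoly \<Rightarrow> bool" where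
  "vanishes_on X F \<longleftrightarrow> (\<forall>P\<in>X. \<forall>v\<in>P. mpoly_eval v F = 0)"

definition dir_deriv :: "complex mpoly \<Rightarrow> (nat \<Rightarrow> complex) \<Rightarrow> (nat \<Rightarrow> complex) \<Rightarrow> complex" where
  "dir_deriv F v w = deriv (\<lambda>s. mpoly_eval (\<lambda>i. v i + s * w i) F) 0"

text \<open>The quadratic form given by the Hessian matrix of \<open>F\<close> at \<open>v\<close>, and its polar form.\<close>

definition hessian :: "complex mpoly \<Rightarrow> (nat \<Rightarrow> complex) \<Rightarrow> (nat \<Rightarrow> complex) \<Rightarrow> complex" where
  "hessian F v w = (deriv ^^ 2) (\<lambda>s. mpoly_eval (\<lambda>i. v i + s * w i) F) 0"

definition hessian_polar ::
  "complex mpoly \<Rightarrow> (nat \<Rightarrow> complex) \<Rightarrow> (nat \<Rightarrow> complex) \<Rightarrow> (nat \<Rightarrow> complex) \<Rightarrow> complex" where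
  "hessian_polar F v w w' =
     hessian F v (\<lambda>i. w i + w' i) - hessian F v w - hessian F v w'"

text \<open>The Zariski tangent space at \<open>v\<close> of the affine cone over \<open>X\<close>.  It contains \<open>v\<close>, and its
  quotient by the line through \<open>v\<close> is (non-canonically) the tangent space of \<open>X\<close> at the point
  with coordinates \<open>v\<close>.\<close>

definition cone_tangent :: "nat \<Rightarrow> point set \<Rightarrow> (nat \<Rightarrow> complex) \<Rightarrow> (nat \<Rightarrow> complex) set" where
  "cone_tangent N X v = {w \<in> cvec N. \<forall>F. vanishes_on X F \<longrightarrow> dir_deriv F v w = 0}"

definition complex_dim :: "(nat \<Rightarrow> complex) set \<Rightarrow> nat" where
  "complex_dim V = vector_space.dim (\<lambda>(c::complex) v i. c * v i) V"

lemma vector_space_sequences: "vector_space (\<lambda>(c::complex) (v::nat \<Rightarrow> complex) i. c * v i)"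
  by unfold_locales (auto simp: algebra_simps fun_eq_iff)

text \<open>All tangent spaces of \<open>X\<close> have dimension \<open>d\<close>.  For irreducible \<open>X\<close>, whose dimension is the
  minimum of the dimensions of its tangent spaces, this says that \<open>X\<close> is smooth of dimension \<open>d\<close>.\<close>

definition smooth_of_dim :: "nat \<Rightarrow> nat \<Rightarrow> point set \<Rightarrow> bool" where
  "smooth_of_dim N d X \<longleftrightarrow> (\<forall>P\<in>X. \<forall>v\<in>P. complex_dim (cone_tangent N X v) = d + 1)"

definition smooth_projective_variety :: "complex set \<Rightarrow> nat \<Rightarrow> nat \<Rightarrow> point set \<Rightarrow> bool" where
  "smooth_projective_variety k N d X \<longleftrightarrow>
     proj_closed k N X \<and> irreducible_set N X \<and> smooth_of_dim N d X"

section \<open>Morphisms\<close>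

text \<open>Near \<open>P\<close>, namely where the homogeneous polynomial \<open>G\<close> does not vanish, the map \<open>f\<close> on \<open>X\<close> is
  \<open>[F 0 : F 1 : \<dots>]\<close> with homogeneous \<open>F i\<close> of equal degree.  If \<open>f\<close> has values in \<open>proj_space M\<close>,
  then the equation for \<open>f Q\<close> forces the \<open>F i\<close> not to vanish simultaneously at \<open>Q\<close>, and to vanish
  there for \<open>i > M\<close>.\<close>

definition local_rep ::
  "complex set \<Rightarrow> point set \<Rightarrow> (point \<Rightarrow> point) \<Rightarrow> point \<Rightarrow> (nat \<Rightarrow> complex mpoly) \<Rightarrow> bool" where
  "local_rep k X f P F \<longleftrightarrow>
     (\<exists>d. \<forall>i. homogeneous d (F i)) \<and> (\<forall>i. has_coeffs_in k (F i)) \<and>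
     (\<exists>G e. homogeneous e G \<and> has_coeffs_in k G \<and> (\<forall>v\<in>P. mpoly_eval v G \<noteq> 0) \<and>
        (\<forall>Q\<in>X. \<forall>v\<in>Q. mpoly_eval v G \<noteq> 0 \<longrightarrow> f Q = proj_pt (\<lambda>i. mpoly_eval v (F i))))"

text \<open>Here \<open>X\<close> and \<open>Y\<close> may be quasi-projective.\<close>

definition morphism :: "complex set \<Rightarrow> point set \<Rightarrow> point set \<Rightarrow> (point \<Rightarrow> point) \<Rightarrow> bool" where
  "morphism k X Y f \<longleftrightarrow> f ` X \<subseteq> Y \<and> (\<forall>P\<in>X. \<exists>F. local_rep k X f P F)"

definition isomorphism :: "complex set \<Rightarrow> point set \<Rightarrow> point set \<Rightarrow> (point \<Rightarrow> point) \<Rightarrow> bool" where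
  "isomorphism k X Y f \<longleftrightarrow> morphism k X Y f \<and>
     (\<exists>g. morphism k Y X g \<and> (\<forall>P\<in>X. g (f P) = P) \<and> (\<forall>Q\<in>Y. f (g Q) = Q))"

definition birational_morphism ::
  "complex set \<Rightarrow> nat \<Rightarrow> point set \<Rightarrow> nat \<Rightarrow> point set \<Rightarrow> (point \<Rightarrow> point) \<Rightarrow> bool" where
  "birational_morphism k N X M Y f \<longleftrightarrow> morphism k X Y f \<and>
     (\<exists>U V. open_subset k N X U \<and> U \<noteq> {} \<and> open_subset k M Y V \<and> V \<noteq> {} \<and> isomorphism k U V f)"

text \<open>The Segre embedding, for a second factor in \<open>\<P>\<^sup>M\<close>: coordinate \<open>i * (M + 1) + j\<close> is \<open>v\<^sub>i w\<^sub>j\<close>.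
  Products of varieties are their images under it.\<close>

definition segre :: "nat \<Rightarrow> point \<Rightarrow> point \<Rightarrow> point" where
  "segre M P Q = {(\<lambda>l. v (l div (M + 1)) * w (l mod (M + 1))) | v w. v \<in> P \<and> w \<in> Q}"

definition product_variety :: "nat \<Rightarrow> point set \<Rightarrow> point set \<Rightarrow> point set" where
  "product_variety M X Y = {segre M P Q | P Q. P \<in> X \<and> Q \<in> Y}"

section \<open>Elliptic curves and their rank\<close>

definition curve_group ::
  "nat \<Rightarrow> point set \<Rightarrow> point \<Rightarrow> (point \<Rightarrow> point) \<Rightarrow> point monoid" where
  "curve_group N E O\<^sub>E \<mu> =
     \<lparr>carrier = E, monoid.mult = (\<lambda>P Q. \<mu> (segre N P Q)), one = O\<^sub>E\<rparr>"

text \<open>An elliptic curve over \<open>k\<close> is a smooth projective (geometrically irreducible) curve with a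
  \<open>k\<close>-rational origin and a group structure given by morphisms over \<open>k\<close>, i.e. an abelian variety of
  dimension one.  The addition \<open>\<mu>\<close>, a morphism on the product \<open>E \<times> E\<close>, is determined by the origin.\<close>

definition elliptic_curve ::
  "complex set \<Rightarrow> nat \<Rightarrow> point set \<Rightarrow> point \<Rightarrow> (point \<Rightarrow> point) \<Rightarrow> bool" where
  "elliptic_curve k N E O\<^sub>E \<mu> \<longleftrightarrow>
     smooth_projective_variety k N 1 E \<and> O\<^sub>E \<in> rational_points k E \<and>
     comm_group (curve_group N E O\<^sub>E \<mu>) \<and>
     morphism k (product_variety N E E) E \<mu> \<and>
     morphism k E E (m_inv (curve_group N E O\<^sub>E \<mu>))"

definition mordell_weil_group ::
  "complex set \<Rightarrow> nat \<Rightarrow> point set \<Rightarrow> point \<Rightarrow> (point \<Rightarrow> point) \<Rightarrow> point monoid" where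
  "mordell_weil_group k N E O\<^sub>E \<mu> =
     (curve_group N E O\<^sub>E \<mu>)\<lparr>carrier := rational_points k E\<rparr>"

definition int_independent :: "('a, 'b) monoid_scheme \<Rightarrow> 'a set \<Rightarrow> bool" where
  "int_independent G S \<longleftrightarrow> finite S \<and> S \<subseteq> carrier G \<and>
     (\<forall>c :: 'a \<Rightarrow> int. finprod G (\<lambda>s. s [^]\<^bsub>G\<^esub> c s) S = \<one>\<^bsub>G\<^esub> \<longrightarrow> (\<forall>s\<in>S. c s = 0))"

definition abelian_rank :: "('a, 'b) monoid_scheme \<Rightarrow> enat" where
  "abelian_rank G = (SUP S\<in>{S. int_independent G S}. enat (card S))"

section \<open>Elliptic surfaces over the rational numbers\<close>

abbreviation proj_line :: "point set" where
  "proj_line \<equiv> proj_space 1"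

definition line_pt :: "complex \<Rightarrow> complex \<Rightarrow> point" where
  "line_pt x y = proj_pt (\<lambda>i. if i = 0 then x else if i = 1 then y else 0)"

definition fibre :: "point set \<Rightarrow> (point \<Rightarrow> point) \<Rightarrow> point \<Rightarrow> point set" where
  "fibre X \<pi> b = {P \<in> X. \<pi> P = b}"

text \<open>If \<open>\<pi> = [A : B]\<close> near \<open>P\<close> and \<open>\<pi> P = [\<beta>\<^sub>0 : \<beta>\<^sub>1]\<close>, then \<open>\<beta>\<^sub>1 A - \<beta>\<^sub>0 B\<close> is an equation near \<open>P\<close>
  of the scheme-theoretic fibre through \<open>P\<close>.\<close>

definition fibre_equation ::
  "point set \<Rightarrow> (point \<Rightarrow> point) \<Rightarrow> point \<Rightarrow> complex mpoly \<Rightarrow> bool" where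
  "fibre_equation X \<pi> P h \<longleftrightarrow>
     (\<exists>F \<beta>. local_rep UNIV X \<pi> P F \<and> \<beta> \<in> \<pi> P \<and>
        h = Poly_Mapping.single 0 (\<beta> 1) * F 0 - Poly_Mapping.single 0 (\<beta> 0) * F 1)"

text \<open>The scheme-theoretic fibre through \<open>P\<close> is smooth at \<open>P\<close>: its equation has nonzero differential
  on the tangent space of \<open>X\<close>.\<close>

definition fibre_smooth_at :: "nat \<Rightarrow> point set \<Rightarrow> (point \<Rightarrow> point) \<Rightarrow> point \<Rightarrow> bool" where
  "fibre_smooth_at N X \<pi> P \<longleftrightarrow>
     (\<exists>h. fibre_equation X \<pi> P h \<and> (\<exists>v\<in>P. \<exists>w\<in>cone_tangent N X v. dir_deriv h v w \<noteq> 0))"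

text \<open>The scheme-theoretic fibre through \<open>P\<close> has a node (ordinary double point) at \<open>P\<close>: on the
  surface \<open>X\<close> its equation vanishes to second order with nondegenerate quadratic term.  To compute
  this term the equation \<open>h\<close> is corrected by some \<open>g\<close> in the ideal of \<open>X\<close> so that all its first
  partial derivatives vanish; the Hessian of \<open>h - g\<close> on the tangent space is then independent of
  the choice of \<open>g\<close>.  The radical of the Hessian always contains the direction \<open>v\<close> of the cone.\<close>

definition fibre_node_at :: "nat \<Rightarrow> point set \<Rightarrow> (point \<Rightarrow> point) \<Rightarrow> point \<Rightarrow> bool" where
  "fibre_node_at N X \<pi> P \<longleftrightarrow>
     (\<exists>h g. fibre_equation X \<pi> P h \<and> vanishes_on X g \<and>
       (\<exists>v\<in>P. (\<forall>w\<in>cvec N. dir_deriv (h - g) v w = 0) \<and>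
          {w \<in> cone_tangent N X v. \<forall>w'\<in>cone_tangent N X v. hessian_polar (h - g) v w w' = 0}
            = {(\<lambda>i. c * v i) | c. True}))"

text \<open>The fibre over \<open>b\<close>, as a scheme over \<open>k\<close>, is an elliptic curve with origin \<open>\<sigma> b\<close> and addition \<open>\<mu>\<close>.\<close>

definition elliptic_fibre ::
  "complex set \<Rightarrow> nat \<Rightarrow> point set \<Rightarrow> (point \<Rightarrow> point) \<Rightarrow> (point \<Rightarrow> point) \<Rightarrow> point
     \<Rightarrow> (point \<Rightarrow> point) \<Rightarrow> bool" where
  "elliptic_fibre k N X \<pi> \<sigma> b \<mu> \<longleftrightarrow>
     elliptic_curve k N (fibre X \<pi> b) (\<sigma> b) \<mu> \<and> (\<forall>P\<in>fibre X \<pi> b. fibre_smooth_at N X \<pi> P)"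

definition rat_adjoin :: "complex \<Rightarrow> complex set" where
  "rat_adjoin \<tau> = {poly p \<tau> / poly q \<tau> | p q.
     (\<forall>i. coeff p i \<in> \<rat>) \<and> (\<forall>i. coeff q i \<in> \<rat>) \<and> poly q \<tau> \<noteq> 0}"

text \<open>Relatively minimal: every birational morphism over \<open>\<P>\<^sup>1\<close> to a smooth projective surface is an
  isomorphism, i.e. no curve in a fibre can be contracted to a smooth point.\<close>

definition relatively_minimal :: "nat \<Rightarrow> point set \<Rightarrow> (point \<Rightarrow> point) \<Rightarrow> bool" where
  "relatively_minimal N X \<pi> \<longleftrightarrow>
     (\<forall>M Y \<rho> f. smooth_projective_variety \<rat> M 2 Y \<longrightarrow> morphism \<rat> Y proj_line \<rho> \<longrightarrow>
        birational_morphism \<rat> N X M Y f \<longrightarrow> (\<forall>P\<in>X. \<rho> (f P) = \<pi> P) \<longrightarrow> isomorphism \<rat> X Y f)"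

text \<open>For \<open>\<tau>\<close> transcendental over \<open>\<rat>\<close>, the point \<open>[\<tau> : 1]\<close> is a generic point of \<open>\<P>\<^sup>1\<close> over \<open>\<rat>\<close> in the
  sense of Weil: under the isomorphism of the function field \<open>\<rat>(t)\<close> with \<open>\<rat>(\<tau>)\<close>, the generic fibre
  is the fibre over \<open>[\<tau> : 1]\<close>, a curve over \<open>\<rat>(\<tau>)\<close>.\<close>

definition elliptic_surface ::
  "nat \<Rightarrow> point set \<Rightarrow> (point \<Rightarrow> point) \<Rightarrow> (point \<Rightarrow> point) \<Rightarrow> bool" where
  "elliptic_surface N X \<pi> \<sigma> \<longleftrightarrow>
     smooth_projective_variety \<rat> N 2 X \<and>
     morphism \<rat> X proj_line \<pi> \<and>
     morphism \<rat> proj_line X \<sigma> \<and> (\<forall>b\<in>proj_line. \<pi> (\<sigma> b) = b) \<and>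
     (\<forall>\<tau>. \<not> algebraic \<tau> \<longrightarrow> (\<exists>\<mu>. elliptic_fibre (rat_adjoin \<tau>) N X \<pi> \<sigma> (line_pt \<tau> 1) \<mu>)) \<and>
     relatively_minimal N X \<pi>"

section \<open>Rational curves and fibres of multiplicative type\<close>

text \<open>Possibly singular rational curves over \<open>\<complex>\<close>: images of nonconstant morphisms from \<open>\<P>\<^sup>1\<close>.\<close>

definition rational_curve_on :: "point set \<Rightarrow> point set \<Rightarrow> bool" where
  "rational_curve_on X C \<longleftrightarrow>
     (\<exists>f. morphism UNIV proj_line X f \<and> (\<exists>P\<in>proj_line. \<exists>Q\<in>proj_line. f P \<noteq> f Q) \<and>
          C = f ` proj_line)"

text \<open>Kodaira type \<open>I\<^sub>n\<close>: for \<open>n = 1\<close> a rational curve with one node, for \<open>n \<ge> 2\<close> a cycle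
  \<open>\<Theta>\<^sub>0, \<dots>, \<Theta>\<^sub>n\<^sub>-\<^sub>1\<close> of smooth rational curves, in which \<open>\<Theta>\<^sub>i\<close> and the next component meet transversally
  at \<open>p\<^sub>i\<close> (for \<open>n = 2\<close> the two components meet at the two points \<open>p\<^sub>0, p\<^sub>1\<close>).  The scheme-theoretic
  fibre is smooth away from the \<open>p\<^sub>i\<close>, so all components have multiplicity one.\<close>

definition kodaira_I ::
  "nat \<Rightarrow> nat \<Rightarrow> point set \<Rightarrow> (point \<Rightarrow> point) \<Rightarrow> point \<Rightarrow> bool" where
  "kodaira_I n N X \<pi> b \<longleftrightarrow>
     (\<exists>\<Theta> p. inj_on \<Theta> {..<n} \<and> inj_on p {..<n} \<and>
        (\<forall>i<n. rational_curve_on (fibre X \<pi> b) (\<Theta> i)) \<and>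
        (n \<ge> 2 \<longrightarrow> (\<forall>i<n. smooth_of_dim N 1 (\<Theta> i))) \<and>
        fibre X \<pi> b = (\<Union>i<n. \<Theta> i) \<and>
        (\<forall>i<n. p i \<in> fibre X \<pi> b \<and> fibre_node_at N X \<pi> (p i)) \<and>
        (\<forall>P\<in>fibre X \<pi> b - p ` {..<n}. fibre_smooth_at N X \<pi> P) \<and>
        (\<forall>i<n. \<forall>j<n. i \<noteq> j \<longrightarrow> \<Theta> i \<inter> \<Theta> j = {p l | l. l < n \<and> {i, j} = {l, Suc l mod n}}))"

definition multiplicative_fibre :: "nat \<Rightarrow> point set \<Rightarrow> (point \<Rightarrow> point) \<Rightarrow> point \<Rightarrow> bool" where
  "multiplicative_fibre N X \<pi> b \<longleftrightarrow> (\<exists>n\<ge>1. kodaira_I n N X \<pi> b)"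

section \<open>The conjectures\<close>

text \<open>An affine chart of \<open>\<P>\<^sup>1\<close> over \<open>\<rat>\<close> with its coordinate \<open>t\<close> is given by an invertible matrix: the
  point with coordinate \<open>t\<close> is \<open>[\<alpha> t + \<beta> : \<gamma> t + \<delta>]\<close>.\<close>

definition conjecture_A :: bool where
  "conjecture_A \<longleftrightarrow>
     (\<forall>N X \<pi> \<sigma> \<alpha> \<beta> \<gamma> \<delta>.
        elliptic_surface N X \<pi> \<sigma> \<longrightarrow>
        \<alpha> \<in> \<rat> \<longrightarrow> \<beta> \<in> \<rat> \<longrightarrow> \<gamma> \<in> \<rat> \<longrightarrow> \<delta> \<in> \<rat> \<longrightarrow> \<alpha> * \<delta> - \<beta> * \<gamma> \<noteq> 0 \<longrightarrow>
        (let pt = (\<lambda>t. line_pt (\<alpha> * t + \<beta>) (\<gamma> * t + \<delta>)) in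
          (\<exists>t. multiplicative_fibre N X \<pi> (pt t)) \<longrightarrow>
          (\<exists>c>0. \<forall>\<^sub>F x :: real in at_top.
             real (card {n :: nat. 1 \<le> n \<and> real n \<le> x \<and>
               (\<exists>\<mu>. elliptic_fibre \<rat> N X \<pi> \<sigma> (pt (of_nat n)) \<mu> \<and>
                  abelian_rank (mordell_weil_group \<rat> N (fibre X \<pi> (pt (of_nat n)))
                    (\<sigma> (pt (of_nat n))) \<mu>) > 0)})
             \<ge> c * x)))"

definition conjecture_C :: bool where
  "conjecture_C \<longleftrightarrow>
     (\<exists>N X \<pi> \<sigma>. elliptic_surface N X \<pi> \<sigma> \<and>
        (\<exists>b\<in>proj_line. multiplicative_fibre N X \<pi> b) \<and>
        finite {C. rational_curve_on X C})"

end

theory Submission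
  imports Defs "HOL-Computational_Algebra.Polynomial_Factorial"
    "HOL-Analysis.Function_Topology" "HOL-Algebra.Multiplicative_Group"
begin

text \<open>Let \<open>X \<rightarrow> \<P>\<^sup>1\<close> be the surface of Conjecture C.  A \<open>\<rat>(z)\<close>-point of \<open>X\<close> lying over a nonconstant
  \<open>s \<in> \<rat>(z)\<close> parametrizes a rational curve on \<open>X\<close> which dominates \<open>\<P>\<^sup>1\<close>.  There are finitely many such
  curves and each meets every fibre in boundedly many points, so for a suitable \<open>R\<close> no nonconstant
  \<open>s\<close> has \<open>R\<close> distinct \<open>\<rat>(z)\<close>-points above it.  Hence the Diophantine set \<open>D\<close> of all \<open>s\<close> with at least
  \<open>R\<close> points above them consists of constants, with no need to remove the rational curves
  themselves.  By Conjecture A it contains a set of positive integers of positive lower density,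
  since a fibre of positive rank has infinitely many rational points.  A pigeonhole argument
  represents every rational number as \<open>(a - a') / (b - b')\<close> with \<open>a, a', b, b' \<in> D\<close>.\<close>

text \<open>The number \<open>R\<close> must be fixed before \<open>s\<close>, although the degree
  of a parametrization grows with that of \<open>s\<close>. This is possible because the number of
  points in a fibre belongs to the curve as a set: a single parametrization over a nonconstant value
  shows that the curve has some bound, and since there are finitely many rational curves these
  bounds can be added. Several \<open>\<rat>(z)\<close>-points over \<open>s\<close> are compared at
  one generically chosen complex number z, where they become distinct points of a single fibre, the
  one over s(z). Curves inside fibres, such as the components of the multiplicative fibre, never
  arise from nonconstant \<open>s\<close>. To be Diophantine, \<open>D\<close> needs finitely many
  polynomial conditions, while a morphism is given by formulas that vary from point to point; hence
  the finite family of charts. Conjecture A tells how many integers lie in \<open>D\<close> but not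
  which, whence the passage to quotients of differences; these stay constant because
  \<open>D\<close> contains only constants.\<close>

section \<open>Evaluation of multivariate polynomials is a ring homomorphism\<close>

lemma mpoly_eval_superset:
  assumes "finite A" "Poly_Mapping.keys F \<subseteq> A"
  shows "mpoly_eval v F =
     (\<Sum>e\<in>A. Poly_Mapping.lookup F e * (\<Prod>i\<in>Poly_Mapping.keys e. v i ^ Poly_Mapping.lookup e i))"
  unfolding mpoly_eval_def using assms
  by (intro sum.mono_neutral_left) (auto simp: in_keys_iff)

lemma mpoly_eval_add: "mpoly_eval v (F + G) = mpoly_eval v F + mpoly_eval v G"
proof -
  let ?A = "Poly_Mapping.keys F \<union> Poly_Mapping.keys G"
  have "Poly_Mapping.keys (F + G) \<subseteq> ?A" by (rule Poly_Mapping.keys_add)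
  then show ?thesis
    by (subst (1 2 3) mpoly_eval_superset[of ?A])
      (auto simp: lookup_add distrib_right sum.distrib)
qed

lemma mpoly_eval_0 [simp]: "mpoly_eval v 0 = 0"
  by (simp add: mpoly_eval_def)

lemma mpoly_eval_sum: "mpoly_eval v (sum f A) = (\<Sum>x\<in>A. mpoly_eval v (f x))"
  by (induction A rule: infinite_finite_induct) (auto simp: mpoly_eval_add)

lemma mpoly_eval_single:
  "mpoly_eval v (Poly_Mapping.single e c) =
     c * (\<Prod>i\<in>Poly_Mapping.keys e. v i ^ Poly_Mapping.lookup e i)"
  by (subst mpoly_eval_superset[of "{e}"]) (auto)

lemma monomial_eval_add:
  fixes v :: "nat \<Rightarrow> 'a::comm_semiring_1" and d e :: "nat \<Rightarrow>\<^sub>0 nat"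
  shows "(\<Prod>i\<in>Poly_Mapping.keys (d + e). v i ^ Poly_Mapping.lookup (d + e) i) =
     (\<Prod>i\<in>Poly_Mapping.keys d. v i ^ Poly_Mapping.lookup d i) *
     (\<Prod>i\<in>Poly_Mapping.keys e. v i ^ Poly_Mapping.lookup e i)"
proof -
  let ?A = "Poly_Mapping.keys d \<union> Poly_Mapping.keys e"
  have *: "(\<Prod>i\<in>Poly_Mapping.keys f. v i ^ Poly_Mapping.lookup f i) =
      (\<Prod>i\<in>?A. v i ^ Poly_Mapping.lookup f i)" if "Poly_Mapping.keys f \<subseteq> ?A" for f
    using that by (intro prod.mono_neutral_left) (auto simp: in_keys_iff)
  show ?thesis
    by (subst (1 2 3) *) (auto simp: Poly_Mapping.keys_add lookup_add power_add prod.distrib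
        dest: Poly_Mapping.keys_add[THEN subsetD])
qed

lemma poly_mapping_eq_sum_single:
  "F = (\<Sum>e\<in>Poly_Mapping.keys F. Poly_Mapping.single e (Poly_Mapping.lookup F e))"
  by (rule poly_mapping_eqI)
    (auto simp: lookup_sum lookup_single when_def in_keys_iff sum.delta)

lemma mpoly_eval_mult: "mpoly_eval v (F * G) = mpoly_eval v F * mpoly_eval v G"
proof -
  have "mpoly_eval v (F * G) = mpoly_eval v
     ((\<Sum>e\<in>Poly_Mapping.keys F. Poly_Mapping.single e (Poly_Mapping.lookup F e)) *
      (\<Sum>e\<in>Poly_Mapping.keys G. Poly_Mapping.single e (Poly_Mapping.lookup G e)))"
    using poly_mapping_eq_sum_single by metis
  also have "\<dots> = (\<Sum>d\<in>Poly_Mapping.keys F. \<Sum>e\<in>Poly_Mapping.keys G.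
      mpoly_eval v (Poly_Mapping.single d (Poly_Mapping.lookup F d)) *
      mpoly_eval v (Poly_Mapping.single e (Poly_Mapping.lookup G e)))"
    by (simp add: sum_product mpoly_eval_sum mult_single mpoly_eval_single monomial_eval_add
        algebra_simps)
  also have "\<dots> = mpoly_eval v F * mpoly_eval v G"
    by (simp add: sum_product[symmetric] mpoly_eval_single)
      (simp add: mpoly_eval_def)
  finally show ?thesis .
qed

section \<open>Diophantine predicates\<close>

text \<open>Polynomial maps are handled as functions on valuations of any index type, so that
  substitution is a plain induction; formal polynomials return only through
  \<open>polyfun_eq_mpoly_eval\<close>.\<close>

inductive polyfun :: "(('i \<Rightarrow> 'a::comm_ring_1) \<Rightarrow> 'a) \<Rightarrow> bool" where
  const: "polyfun (\<lambda>w. c)"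
| var: "polyfun (\<lambda>w. w i)"
| add: "polyfun f \<Longrightarrow> polyfun g \<Longrightarrow> polyfun (\<lambda>w. f w + g w)"
| mult: "polyfun f \<Longrightarrow> polyfun g \<Longrightarrow> polyfun (\<lambda>w. f w * g w)"

declare polyfun.intros [intro]

lemma polyfun_uminus: "polyfun f \<Longrightarrow> polyfun (\<lambda>w. - f w)"
  using polyfun.mult[OF polyfun.const[of "-1"], of f] by simp

lemma polyfun_diff: "polyfun f \<Longrightarrow> polyfun g \<Longrightarrow> polyfun (\<lambda>w. f w - g w)"
  using polyfun.add[OF _ polyfun_uminus, of f g] by simp

lemma polyfun_power: "polyfun f \<Longrightarrow> polyfun (\<lambda>w. f w ^ n)"
  using polyfun.const[of 1] by (induction n) auto

lemma polyfun_sum: "(\<And>x. x \<in> A \<Longrightarrow> polyfun (f x)) \<Longrightarrow> polyfun (\<lambda>w. \<Sum>x\<in>A. f x w)"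
  by (induction A rule: infinite_finite_induct) auto

lemma polyfun_prod: "(\<And>x. x \<in> A \<Longrightarrow> polyfun (f x)) \<Longrightarrow> polyfun (\<lambda>w. \<Prod>x\<in>A. f x w)"
  by (induction A rule: infinite_finite_induct) auto

lemma polyfun_subst:
  assumes "polyfun f" "\<And>i. polyfun (g i)"
  shows "polyfun (\<lambda>w. f (\<lambda>i. g i w))"
  using assms(1) by induction (auto intro: assms(2))

lemma polyfun_eq_mpoly_eval:
  fixes f :: "(nat \<Rightarrow> 'a::comm_ring_1) \<Rightarrow> 'a"
  assumes "polyfun f"
  shows "\<exists>F. \<forall>w. f w = mpoly_eval w F"
  using assms
proof induction
  case (const c)
  show ?case by (rule exI[of _ "Poly_Mapping.single 0 c"]) (simp add: mpoly_eval_single)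
next
  case (var i)
  show ?case
    by (rule exI[of _ "Poly_Mapping.single (Poly_Mapping.single i 1) 1"])
      (simp add: mpoly_eval_single)
next
  case (add f g)
  then show ?case by (metis mpoly_eval_add)
next
  case (mult f g)
  then show ?case by (metis mpoly_eval_mult)
qed

text \<open>Membership in a Diophantine set, for valuations over an arbitrary index type; only finitely
  many of the witnesses \<open>y 0, y 1, \<dots>\<close> matter.\<close>

definition dio :: "(('i \<Rightarrow> 'a::comm_ring_1) \<Rightarrow> bool) \<Rightarrow> bool" where
  "dio P \<longleftrightarrow> (\<exists>\<Phi>. finite \<Phi> \<and> (\<forall>f\<in>\<Phi>. polyfun f) \<and>
     (\<forall>w. P w \<longleftrightarrow> (\<exists>y :: nat \<Rightarrow> 'a. \<forall>f\<in>\<Phi>. f (case_sum w y) = 0)))"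

lemma dioI:
  assumes "finite \<Phi>" "\<And>f. f \<in> \<Phi> \<Longrightarrow> polyfun f"
    "\<And>w. P w \<longleftrightarrow> (\<exists>y :: nat \<Rightarrow> 'a::comm_ring_1. \<forall>f\<in>\<Phi>. f (case_sum w y) = 0)"
  shows "dio P"
  using assms unfolding dio_def by blast

lemma dio_eq_0:
  fixes f :: "('i \<Rightarrow> 'a::comm_ring_1) \<Rightarrow> 'a"
  assumes "polyfun f"
  shows "dio (\<lambda>w. f w = 0)"
proof (rule dioI)
  have "polyfun (\<lambda>u :: 'i + nat \<Rightarrow> 'a. f (\<lambda>i. u (Inl i)))"
    using assms polyfun.var by (rule polyfun_subst)
  then show "polyfun g" if "g \<in> {\<lambda>u :: 'i + nat \<Rightarrow> 'a. f (\<lambda>i. u (Inl i))}" for g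
    using that by simp
qed auto

lemma dio_eq: "polyfun f \<Longrightarrow> polyfun g \<Longrightarrow> dio (\<lambda>w. f w = g w)"
  using dio_eq_0[of "\<lambda>w. f w - g w"] polyfun_diff[of f g] by simp

lemma dio_True: "dio (\<lambda>w. True)"
  using dio_eq_0[OF polyfun.const[of 0]] by simp

lemma dio_False: "dio (\<lambda>w. False)"
  using dio_eq_0[OF polyfun.const[of 1]] by simp

lemma dio_subst:
  fixes P :: "('j \<Rightarrow> 'a::comm_ring_1) \<Rightarrow> bool" and g :: "'j \<Rightarrow> ('i \<Rightarrow> 'a) \<Rightarrow> 'a"
  assumes "dio P" "\<And>i. polyfun (g i)"
  shows "dio (\<lambda>w. P (\<lambda>i. g i w))"
proof -
  obtain \<Phi> where \<Phi>: "finite \<Phi>" "\<And>f. f \<in> \<Phi> \<Longrightarrow> polyfun f"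
    "\<And>w. P w \<longleftrightarrow> (\<exists>y :: nat \<Rightarrow> 'a. \<forall>f\<in>\<Phi>. f (case_sum w y) = 0)"
    using assms(1) unfolding dio_def by blast
  let ?h = "\<lambda>u. case_sum (\<lambda>i. g i (\<lambda>i. u (Inl i))) (\<lambda>i. u (Inr i))"
  have pf: "polyfun (\<lambda>u. ?h u k)" for k
    by (cases k) (auto intro!: polyfun_subst[OF assms(2)] polyfun.var)
  have 1: "polyfun (\<lambda>u. f (?h u))" if "f \<in> \<Phi>" for f
    using \<Phi>(2)[OF that] pf by (rule polyfun_subst)
  show ?thesis
    by (rule dioI[of "(\<lambda>f u. f (?h u)) ` \<Phi>"]) (use \<Phi>(1) 1 in \<open>auto simp: \<Phi>(3)\<close>)
qed

text \<open>The equations are all products of one polynomial from each system. If some factor from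
  the first system is nonzero at a witness, the whole second system vanishes there, as there are no
  zero divisors. So both systems can share one witness sequence.\<close>

lemma dio_disj:
  fixes P Q :: "('i \<Rightarrow> 'a::idom) \<Rightarrow> bool"
  assumes "dio P" "dio Q"
  shows "dio (\<lambda>w. P w \<or> Q w)"
proof -
  obtain \<Phi> where \<Phi>: "finite \<Phi>" "\<And>f. f \<in> \<Phi> \<Longrightarrow> polyfun f"
    "\<And>w. P w \<longleftrightarrow> (\<exists>y :: nat \<Rightarrow> 'a. \<forall>f\<in>\<Phi>. f (case_sum w y) = 0)"
    using assms(1) unfolding dio_def by blast
  obtain \<Psi> where \<Psi>: "finite \<Psi>" "\<And>f. f \<in> \<Psi> \<Longrightarrow> polyfun f"
    "\<And>w. Q w \<longleftrightarrow> (\<exists>y :: nat \<Rightarrow> 'a. \<forall>f\<in>\<Psi>. f (case_sum w y) = 0)"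
    using assms(2) unfolding dio_def by blast
  show ?thesis
    by (rule dioI[of "(\<lambda>(f, g) u. f u * g u) ` (\<Phi> \<times> \<Psi>)"])
      (use \<Phi>(1,2) \<Psi>(1,2) in \<open>auto simp: \<Phi>(3) \<Psi>(3)\<close>)
qed

lemma dio_conj:
  fixes P Q :: "('i \<Rightarrow> 'a::comm_ring_1) \<Rightarrow> bool"
  assumes "dio P" "dio Q"
  shows "dio (\<lambda>w. P w \<and> Q w)"
proof -
  obtain \<Phi> where \<Phi>: "finite \<Phi>" "\<And>f. f \<in> \<Phi> \<Longrightarrow> polyfun f"
    "\<And>w. P w \<longleftrightarrow> (\<exists>y :: nat \<Rightarrow> 'a. \<forall>f\<in>\<Phi>. f (case_sum w y) = 0)"
    using assms(1) unfolding dio_def by blast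
  obtain \<Psi> where \<Psi>: "finite \<Psi>" "\<And>f. f \<in> \<Psi> \<Longrightarrow> polyfun f"
    "\<And>w. Q w \<longleftrightarrow> (\<exists>y :: nat \<Rightarrow> 'a. \<forall>f\<in>\<Psi>. f (case_sum w y) = 0)"
    using assms(2) unfolding dio_def by blast
  \<comment> \<open>Each system needs its own witnesses here: the even entries serve
    \<open>P\<close>, the odd ones \<open>Q\<close>.\<close>
  let ?r = "\<lambda>(u :: 'i + nat \<Rightarrow> 'a) k. u (map_sum id (\<lambda>i. 2 * i) k)"
  let ?s = "\<lambda>(u :: 'i + nat \<Rightarrow> 'a) k. u (map_sum id (\<lambda>i. 2 * i + 1) k)"
  have r: "?r (case_sum w y) = case_sum w (\<lambda>i. y (2 * i))"
    and s: "?s (case_sum w y) = case_sum w (\<lambda>i. y (2 * i + 1))" for w y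
    by (auto simp: fun_eq_iff split: sum.splits)
  have 1: "polyfun (\<lambda>u. f (?r u))" if "f \<in> \<Phi>" for f
    using \<Phi>(2)[OF that] by (rule polyfun_subst) auto
  have 2: "polyfun (\<lambda>u. f (?s u))" if "f \<in> \<Psi>" for f
    using \<Psi>(2)[OF that] by (rule polyfun_subst) auto
  show ?thesis
  proof (rule dioI[of "(\<lambda>f u. f (?r u)) ` \<Phi> \<union> (\<lambda>f u. f (?s u)) ` \<Psi>"])
    fix w
    show "(P w \<and> Q w) \<longleftrightarrow>
      (\<exists>y. \<forall>f\<in>(\<lambda>f u. f (?r u)) ` \<Phi> \<union> (\<lambda>f u. f (?s u)) ` \<Psi>. f (case_sum w y) = 0)"
      (is "?L \<longleftrightarrow> ?R")
    proof
      assume ?L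
      then obtain y1 y2 where "\<forall>f\<in>\<Phi>. f (case_sum w y1) = 0" "\<forall>f\<in>\<Psi>. f (case_sum w y2) = 0"
        using \<Phi>(3) \<Psi>(3) by blast
      then show ?R
        by (intro exI[of _ "\<lambda>i. if even i then y1 (i div 2) else y2 (i div 2)"])
          (auto simp: r s simp del: One_nat_def)
    next
      assume ?R
      then show ?L unfolding \<Phi>(3) \<Psi>(3) ball_Un ball_simps r s by blast
    qed
  qed (use \<Phi>(1) \<Psi>(1) 1 2 in auto)
qed

text \<open>A whole sequence is quantified at once, so that later a matrix of unknowns can be packed
  into it. The even entries of the new witness carry y, the odd ones the witnesses of the inner
  system.\<close>

lemma dio_ex:
  fixes P :: "('i \<Rightarrow> 'a::comm_ring_1) \<Rightarrow> (nat \<Rightarrow> 'a) \<Rightarrow> bool"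
  assumes "dio (\<lambda>u. P (\<lambda>i. u (Inl i)) (\<lambda>i. u (Inr i)))"
  shows "dio (\<lambda>w. \<exists>y. P w y)"
proof -
  obtain \<Phi> where \<Phi>: "finite \<Phi>" "\<And>f. f \<in> \<Phi> \<Longrightarrow> polyfun f"
    "\<And>u. P (\<lambda>i. u (Inl i)) (\<lambda>i. u (Inr i)) \<longleftrightarrow>
       (\<exists>y :: nat \<Rightarrow> 'a. \<forall>f\<in>\<Phi>. f (case_sum u y) = 0)"
    using assms unfolding dio_def by blast
  let ?r = "\<lambda>(u :: 'i + nat \<Rightarrow> 'a). case_sum (case_sum (\<lambda>i. u (Inl i)) (\<lambda>i. u (Inr (2 * i))))
      (\<lambda>i. u (Inr (2 * i + 1)))"
  have pf: "polyfun (\<lambda>u. ?r u k)" for k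
  proof (cases k)
    case (Inl l)
    then show ?thesis by (cases l) auto
  qed auto
  have 1: "polyfun (\<lambda>u. f (?r u))" if "f \<in> \<Phi>" for f
    using \<Phi>(2)[OF that] pf by (rule polyfun_subst)
  have P: "P w y \<longleftrightarrow> (\<exists>z. \<forall>f\<in>\<Phi>. f (case_sum (case_sum w y) z) = 0)" for w y
    using \<Phi>(3)[of "case_sum w y"] by simp
  show ?thesis
  proof (rule dioI[of "(\<lambda>f u. f (?r u)) ` \<Phi>"])
    fix w
    show "(\<exists>y. P w y) \<longleftrightarrow> (\<exists>y. \<forall>f\<in>(\<lambda>f u. f (?r u)) ` \<Phi>. f (case_sum w y) = 0)"
      (is "?L \<longleftrightarrow> ?R")
    proof
      assume ?L
      then obtain y z where "\<forall>f\<in>\<Phi>. f (case_sum (case_sum w y) z) = 0"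
        using P by blast
      then show ?R
        by (intro exI[of _ "\<lambda>i. if even i then y (i div 2) else z (i div 2)"]) auto
    next
      assume ?R
      then show ?L unfolding P ball_simps by auto
    qed
  qed (use \<Phi>(1) 1 in auto)
qed

lemma dio_ball:
  assumes "finite A" "\<And>x. x \<in> A \<Longrightarrow> dio (P x)"
  shows "dio (\<lambda>w. \<forall>x\<in>A. P x w)"
  using assms by (induction A) (auto intro: dio_True dio_conj)

lemma dio_bex:
  fixes P :: "'x \<Rightarrow> ('i \<Rightarrow> 'a::idom) \<Rightarrow> bool"
  assumes "finite A" "\<And>x. x \<in> A \<Longrightarrow> dio (P x)"
  shows "dio (\<lambda>w. \<exists>x\<in>A. P x w)"
  using assms by (induction A) (auto intro: dio_False dio_disj)

text \<open>In a field, two elements differ exactly if their difference has an inverse, and the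
  inverse is the witness.\<close>

lemma dio_neq:
  fixes f g :: "('i \<Rightarrow> 'a::field) \<Rightarrow> 'a"
  assumes "polyfun f" "polyfun g"
  shows "dio (\<lambda>w. f w \<noteq> g w)"
proof -
  have "(f w \<noteq> g w) \<longleftrightarrow> (\<exists>y :: nat \<Rightarrow> 'a. (f w - g w) * y 0 - 1 = 0)" for w
  proof
    assume "f w \<noteq> g w"
    then show "\<exists>y :: nat \<Rightarrow> 'a. (f w - g w) * y 0 - 1 = 0"
      by (intro exI[of _ "\<lambda>_. inverse (f w - g w)"]) simp
  qed auto
  moreover have "dio (\<lambda>w. \<exists>y :: nat \<Rightarrow> 'a. (f w - g w) * y 0 - 1 = 0)"
    using polyfun_subst[OF assms(1), of "\<lambda>i u. u (Inl i)"]
      polyfun_subst[OF assms(2), of "\<lambda>i u. u (Inl i)"]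
    by (intro dio_ex dio_eq_0 polyfun_diff polyfun.mult polyfun.const) auto
  ultimately show ?thesis by simp
qed

lemma mpoly_eval_cong:
  assumes "\<And>i. i \<in> mpoly_vars F \<Longrightarrow> v i = w i"
  shows "mpoly_eval v F = mpoly_eval w F"
  unfolding mpoly_eval_def
  by (intro sum.cong prod.cong arg_cong2[where f="(*)"] arg_cong2[where f="(^)"] refl assms)
    (auto simp: mpoly_vars_def)

lemma finite_mpoly_vars: "finite (mpoly_vars F)"
  unfolding mpoly_vars_def by auto

lemma diophantine_if_dio:
  fixes R :: "'a::comm_ring_1 \<Rightarrow> bool"
  assumes "dio (\<lambda>w :: nat \<Rightarrow> 'a. R (w 0))"
  shows "diophantine 1 {[x] | x. R x}"
proof -
  obtain \<Phi> where \<Phi>: "finite \<Phi>" "\<And>f. f \<in> \<Phi> \<Longrightarrow> polyfun f"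
    "\<And>w :: nat \<Rightarrow> 'a. R (w 0) \<longleftrightarrow> (\<exists>y :: nat \<Rightarrow> 'a. \<forall>f\<in>\<Phi>. f (case_sum w y) = 0)"
    using assms unfolding dio_def by blast
  \<comment> \<open>Variable 0 stands for x and variable \<open>Suc i\<close> for witness i. All
    parameters are set to x, since the predicate looks only at \<open>w 0\<close>.\<close>
  let ?r = "\<lambda>(u :: nat \<Rightarrow> 'a). case_sum (\<lambda>i. u 0) (\<lambda>i. u (Suc i))"
  have pf: "polyfun (\<lambda>u. ?r u k)" for k :: "nat + nat"
    by (cases k) auto
  have pf': "polyfun (\<lambda>u. f (?r u))" if "f \<in> \<Phi>" for f
    using \<Phi>(2)[OF that] pf by (rule polyfun_subst)
  have "\<forall>f\<in>\<Phi>. \<exists>F. \<forall>u. f (?r u) = mpoly_eval u F"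
    using polyfun_eq_mpoly_eval[OF pf'] by blast
  then obtain T where T: "\<forall>f\<in>\<Phi>. \<forall>u. f (?r u) = mpoly_eval u (T f)"
    by (rule bchoice[THEN exE])
  \<comment> \<open>Finitely many formal polynomials involve finitely many variables, so
    \<open>n\<close> witnesses can replace the infinite sequence.\<close>
  have "finite (\<Union>f\<in>\<Phi>. mpoly_vars (T f))"
    using \<Phi>(1) finite_mpoly_vars by auto
  then obtain n where "(\<Union>f\<in>\<Phi>. mpoly_vars (T f)) \<subseteq> {..<n}"
    using finite_nat_iff_bounded by blast
  then have n: "mpoly_vars (T f) \<subseteq> {..<1 + n}" if "f \<in> \<Phi>" for f
    using that by fastforce
  have R: "R x \<longleftrightarrow> (\<exists>u. u 0 = x \<and> (\<forall>f\<in>\<Phi>. mpoly_eval u (T f) = 0))" for x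
  proof -
    have "R x \<longleftrightarrow> (\<exists>y. \<forall>f\<in>\<Phi>. f (case_sum (\<lambda>_. x) y) = 0)"
      using \<Phi>(3)[of "\<lambda>_. x"] by simp
    also have "\<dots> \<longleftrightarrow> (\<exists>y. \<forall>f\<in>\<Phi>. mpoly_eval (case_nat x y) (T f) = 0)"
    proof -
      have "f (case_sum (\<lambda>_. x) y) = mpoly_eval (case_nat x y) (T f)" if "f \<in> \<Phi>" for f y
        using T[rule_format, OF that, of "case_nat x y"] by simp
      then show ?thesis by simp
    qed
    also have "\<dots> \<longleftrightarrow> (\<exists>u. u 0 = x \<and> (\<forall>f\<in>\<Phi>. mpoly_eval u (T f) = 0))"
    proof safe
      fix u assume "\<forall>f\<in>\<Phi>. mpoly_eval u (T f) = 0" "x = u 0"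
      moreover have "case_nat (u 0) (\<lambda>i. u (Suc i)) = u"
        by (auto simp: fun_eq_iff split: nat.splits)
      ultimately show "\<exists>y. \<forall>f\<in>\<Phi>. mpoly_eval (case_nat (u 0) y) (T f) = 0" by metis
    qed (metis old.nat.simps(4))
    finally show ?thesis .
  qed
  show ?thesis
    unfolding diophantine_def
  proof (intro conjI exI allI impI)
    show "finite (T ` \<Phi>)" using \<Phi>(1) by simp
    show "\<forall>F\<in>T ` \<Phi>. mpoly_vars F \<subseteq> {..<1 + n}" using n by auto
    fix a :: "'a list" assume "length a = 1"
    then obtain x where a: "a = [x]" by (metis One_nat_def length_0_conv length_Suc_conv)
    show "a \<in> {[x] |x. R x} \<longleftrightarrow>
      (\<exists>y. length y = n \<and> (\<forall>F\<in>T ` \<Phi>. mpoly_eval (\<lambda>i. (a @ y) ! i) F = 0))" (is "?L \<longleftrightarrow> ?R")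
    proof
      assume ?L
      then obtain u where u: "u 0 = x" "\<forall>f\<in>\<Phi>. mpoly_eval u (T f) = 0"
        using a R by auto
      have "mpoly_eval (\<lambda>i. (a @ map (\<lambda>i. u (Suc i)) [0..<n]) ! i) (T f) = 0" if "f \<in> \<Phi>" for f
      proof -
        have "mpoly_eval (\<lambda>i. (a @ map (\<lambda>i. u (Suc i)) [0..<n]) ! i) (T f) = mpoly_eval u (T f)"
          using n[OF that] u(1) a by (intro mpoly_eval_cong) (auto simp: nth_Cons split: nat.splits)
        then show ?thesis using u(2) that by simp
      qed
      then show ?R by (intro exI[of _ "map (\<lambda>i. u (Suc i)) [0..<n]"]) auto
    next
      assume ?R
      then obtain y where "\<forall>f\<in>\<Phi>. mpoly_eval (\<lambda>i. (a @ y) ! i) (T f) = 0" by auto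
      \<comment> \<open>Beyond the end of the list the valuation takes whatever values
        \<open>nth\<close> gives; \<open>R\<close> accepts every valuation with value x at
        0.\<close>
      then show ?L using a R[of x] by (auto intro!: exI[of _ "(!) (x # y)"])
    qed
  qed auto
qed

section \<open>Quotients of differences in a set of positive density\<close>

text \<open>Pigeonhole for \<open>(a, b) \<mapsto> m a - p b\<close>: there are quadratically many pairs, but only linearly
  many values.\<close>

lemma differences_proportional_if_positive_density:
  fixes A :: "nat set" and c :: real and m p :: int
  assumes "c > 0" "m \<noteq> 0"
    and ev: "\<forall>\<^sub>F x :: real in at_top. real (card {n \<in> A. 1 \<le> n \<and> real n \<le> x}) \<ge> c * x"
  shows "\<exists>a\<in>A. \<exists>a'\<in>A. \<exists>b\<in>A. \<exists>b'\<in>A. b \<noteq> b' \<and> m * (int a - int a') = p * (int b - int b')"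
proof -
  define l where "l = real_of_int (\<bar>m\<bar> + \<bar>p\<bar>)"
  obtain x0 where x0: "\<And>x. x \<ge> x0 \<Longrightarrow> real (card {n \<in> A. 1 \<le> n \<and> real n \<le> x}) \<ge> c * x"
    using ev unfolding eventually_at_top_linorder by blast
  \<comment> \<open>Chosen so that X * c^2 >= 2 l + 2 and X >= 1: then c^2 X^2 >= 2 l X + 2 X
    exceeds the number 2 l X + 1 of integers in \<open>{-L..L}\<close>.\<close>
  define X where "X = nat \<lceil>max (max x0 1) ((2 * l + 2) / c^2)\<rceil>"
  have X: "real X \<ge> x0" "real X \<ge> 1" "real X \<ge> (2 * l + 2) / c^2"
    unfolding X_def by linarith+
  define B where "B = {n \<in> A. 1 \<le> n \<and> real n \<le> real X}"
  define f where "f = (\<lambda>(a, b). m * int a - p * int b)"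
  define L where "L = (\<bar>m\<bar> + \<bar>p\<bar>) * int X"
  have finB: "finite B" by (rule finite_subset[of _ "{..X}"]) (auto simp: B_def)
  have range: "f ` (B \<times> B) \<subseteq> {-L..L}"
  proof safe
    fix a b assume ab: "a \<in> B" "b \<in> B"
    have "\<bar>m * int a - p * int b\<bar> \<le> \<bar>m\<bar> * int a + \<bar>p\<bar> * int b"
      using abs_triangle_ineq4[of "m * int a" "p * int b"] by (simp add: abs_mult)
    also have "\<dots> \<le> \<bar>m\<bar> * int X + \<bar>p\<bar> * int X"
      using ab by (intro add_mono mult_left_mono) (auto simp: B_def)
    finally show "f (a, b) \<in> {-L..L}"
      unfolding f_def L_def by (auto simp: algebra_simps abs_le_iff)
  qed
  have "\<not> inj_on f (B \<times> B)"
  proof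
    assume "inj_on f (B \<times> B)"
    then have "card (B \<times> B) \<le> card {-L..L}"
      using range card_inj_on_le by blast
    then have "card B * card B \<le> nat (2 * L + 1)"
      by (simp add: card_cartesian_product algebra_simps)
    then have "real (card B * card B) \<le> real (nat (2 * L + 1))"
      by (rule of_nat_mono)
    also have "L \<ge> 0" unfolding L_def by auto
    then have "real (nat (2 * L + 1)) = 2 * l * real X + 1"
      unfolding L_def l_def by (simp add: algebra_simps)
    finally have 1: "real (card B) * real (card B) \<le> 2 * l * real X + 1" by simp
    have "real (card B) \<ge> c * real X" using x0[OF X(1)] unfolding B_def by simp
    moreover have "c * real X \<ge> 0" using assms(1) by simp
    ultimately have 2: "real (card B) * real (card B) \<ge> (c * real X) * (c * real X)"
      by (intro mult_mono) auto
    have "real X * c^2 \<ge> 2 * l + 2" using X(3) assms(1) by (simp add: field_simps)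
    then have "real X * (real X * c^2) \<ge> real X * (2 * l + 2)"
      by (intro mult_left_mono) auto
    with 1 2 X(2) show False by (simp add: algebra_simps power2_eq_square)
  qed
  then obtain a b a' b' where ab: "a \<in> B" "b \<in> B" "a' \<in> B" "b' \<in> B"
    "f (a, b) = f (a', b')" "(a, b) \<noteq> (a', b')"
    unfolding inj_on_def by auto
  from ab(5) have eq: "m * (int a - int a') = p * (int b - int b')"
    unfolding f_def by (simp add: algebra_simps)
  \<comment> \<open>If b = b', then m \<noteq> 0 forces a = a', and the two pairs would
    coincide.\<close>
  with ab(6) assms(2) have "b \<noteq> b'" by auto
  with eq ab(1-4) show ?thesis unfolding B_def by blast
qed

section \<open>Evaluation of polynomials through a map of the coefficients\<close>

text \<open>The equations of the surface have complex coefficients but must be read over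
  \<open>\<rat>\<close>, \<open>\<rat>[z]\<close> and \<open>\<rat>(z)\<close> as well. The map
  \<open>k\<close> translates the coefficients, and \<open>coeff_eval_hom\<close> compares the
  readings.\<close>

definition coeff_eval :: "('b::zero \<Rightarrow> 'a) \<Rightarrow> (nat \<Rightarrow> 'a::comm_semiring_1) \<Rightarrow> 'b mpoly \<Rightarrow> 'a" where
  "coeff_eval k v F =
     (\<Sum>e\<in>Poly_Mapping.keys F. k (Poly_Mapping.lookup F e) *
        (\<Prod>i\<in>Poly_Mapping.keys e. v i ^ Poly_Mapping.lookup e i))"

lemma mpoly_eval_eq_coeff_eval: "mpoly_eval v F = coeff_eval (\<lambda>c. c) v F"
  unfolding mpoly_eval_def coeff_eval_def ..

lemma coeff_eval_hom:
  fixes h :: "'a::comm_semiring_1 \<Rightarrow> 'b::comm_semiring_1"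
  assumes add: "\<And>x y. h (x + y) = h x + h y" and mult: "\<And>x y. h (x * y) = h x * h y"
    and zero: "h 0 = 0" and one: "h 1 = 1"
  shows "h (coeff_eval k v F) = coeff_eval (\<lambda>c. h (k c)) (\<lambda>i. h (v i)) F"
proof -
  have sum: "h (sum f A) = (\<Sum>x\<in>A. h (f x))" for f and A :: "(nat \<Rightarrow>\<^sub>0 nat) set"
    by (induction A rule: infinite_finite_induct) (auto simp: add zero)
  have prod: "h (prod f A) = (\<Prod>x\<in>A. h (f x))" for f and A :: "nat set"
    by (induction A rule: infinite_finite_induct) (auto simp: mult one)
  have power: "h (x ^ n) = h x ^ n" for x n
    by (induction n) (auto simp: mult one)
  show ?thesis unfolding coeff_eval_def sum mult prod power ..
qed

lemma coeff_eval_scale: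
  assumes "homogeneous d F"
  shows "coeff_eval k (\<lambda>i. c * v i) F = c ^ d * coeff_eval k v F"
proof -
  have "(\<Prod>i\<in>Poly_Mapping.keys e. (c * v i) ^ Poly_Mapping.lookup e i) =
      c ^ d * (\<Prod>i\<in>Poly_Mapping.keys e. v i ^ Poly_Mapping.lookup e i)"
    if "e \<in> Poly_Mapping.keys F" for e
    using assms that unfolding homogeneous_def
    by (auto simp: power_mult_distrib prod.distrib power_sum[symmetric])
  then show ?thesis
    unfolding coeff_eval_def sum_distrib_left by (intro sum.cong) (auto simp: algebra_simps)
qed

lemma coeff_eval_cong:
  assumes "\<And>e. k (Poly_Mapping.lookup F e) = k' (Poly_Mapping.lookup F e)"
  shows "coeff_eval k v F = coeff_eval k' v F"
  unfolding coeff_eval_def assms ..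

lemma mpoly_eval_scale:
  "homogeneous d F \<Longrightarrow> mpoly_eval (\<lambda>i. c * v i) F = c ^ d * mpoly_eval v F"
  unfolding mpoly_eval_eq_coeff_eval by (rule coeff_eval_scale)

lemma polyfun_coeff_eval:
  fixes k :: "'b::zero \<Rightarrow> 'a::comm_ring_1"
  assumes "\<And>i. polyfun (g i)"
  shows "polyfun (\<lambda>w. coeff_eval k (\<lambda>i. g i w) F)"
  unfolding coeff_eval_def
  by (intro polyfun_sum polyfun.mult polyfun.const polyfun_prod polyfun_power assms)

section \<open>Reading rational coefficients in the complex numbers, in Q[z] and in Q(z)\<close>

text \<open>The values outside \<open>\<rat>\<close> are arbitrary, so comparisons with complex
  values assume \<open>has_coeffs_in \<rat>\<close>.\<close>

definition rat_of_complex :: "complex \<Rightarrow> rat" where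
  "rat_of_complex = inv_into UNIV of_rat"

lemma of_rat_rat_of_complex: "c \<in> \<rat> \<Longrightarrow> of_rat (rat_of_complex c) = c"
  unfolding rat_of_complex_def Rats_def by (rule f_inv_into_f)

lemma mpoly_eval_eq_coeff_eval_rat:
  assumes "has_coeffs_in \<rat> F"
  shows "mpoly_eval v F = coeff_eval (\<lambda>c. of_rat (rat_of_complex c)) v F"
  unfolding mpoly_eval_eq_coeff_eval
  by (rule coeff_eval_cong) (use assms in \<open>simp add: has_coeffs_in_def of_rat_rat_of_complex\<close>)

definition rat_poly_eval :: "rat poly \<Rightarrow> complex \<Rightarrow> complex" where
  "rat_poly_eval p z = poly (map_poly of_rat p) z"

lemma map_poly_of_rat_add:
  "map_poly of_rat (p + q) = (map_poly of_rat p + map_poly of_rat q :: complex poly)"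
  by (rule poly_eqI) (simp add: coeff_map_poly of_rat_add)

lemma map_poly_of_rat_mult:
  "map_poly of_rat (p * q) = (map_poly of_rat p * map_poly of_rat q :: complex poly)"
  by (rule poly_eqI) (simp add: coeff_map_poly coeff_mult of_rat_sum of_rat_mult)

lemma rat_poly_eval_add: "rat_poly_eval (p + q) z = rat_poly_eval p z + rat_poly_eval q z"
  by (simp add: rat_poly_eval_def map_poly_of_rat_add)

lemma rat_poly_eval_mult: "rat_poly_eval (p * q) z = rat_poly_eval p z * rat_poly_eval q z"
  by (simp add: rat_poly_eval_def map_poly_of_rat_mult)

lemma rat_poly_eval_const [simp]: "rat_poly_eval [:c:] z = of_rat c"
  by (simp add: rat_poly_eval_def map_poly_pCons)

lemma rat_poly_eval_0 [simp]: "rat_poly_eval 0 z = 0"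
  and rat_poly_eval_1 [simp]: "rat_poly_eval 1 z = 1"
  by (simp_all add: rat_poly_eval_def)

lemma rat_poly_eval_diff: "rat_poly_eval (p - q) z = rat_poly_eval p z - rat_poly_eval q z"
  using rat_poly_eval_add[of "p - q" q z] by simp

lemma map_poly_of_rat_eq_0_iff [simp]: "map_poly of_rat p = (0 :: complex poly) \<longleftrightarrow> p = 0"
  by (rule map_poly_eq_0_iff) auto

lemma finite_rat_poly_eval_roots: "p \<noteq> 0 \<Longrightarrow> finite {z. rat_poly_eval p z = 0}"
  unfolding rat_poly_eval_def by (rule poly_roots_finite) simp

type_synonym ratfun = "rat poly fract"

definition ratfun_const :: "rat \<Rightarrow> ratfun" where
  "ratfun_const q = to_fract [:q:]"

lemma ratfun_const_add: "ratfun_const (p + q) = ratfun_const p + ratfun_const q"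
  and ratfun_const_mult: "ratfun_const (p * q) = ratfun_const p * ratfun_const q"
  and ratfun_const_diff: "ratfun_const (p - q) = ratfun_const p - ratfun_const q"
  and ratfun_const_0 [simp]: "ratfun_const 0 = 0"
  and ratfun_const_1 [simp]: "ratfun_const 1 = 1"
  and ratfun_const_eq_iff [simp]: "ratfun_const p = ratfun_const q \<longleftrightarrow> p = q"
proof -
  show "ratfun_const (p + q) = ratfun_const p + ratfun_const q"
    unfolding ratfun_const_def to_fract_add[symmetric] by simp
  show "ratfun_const (p * q) = ratfun_const p * ratfun_const q"
    unfolding ratfun_const_def to_fract_mult[symmetric] by simp
  show "ratfun_const (p - q) = ratfun_const p - ratfun_const q"
    unfolding ratfun_const_def to_fract_diff[symmetric] by simp
qed (simp_all add: ratfun_const_def one_pCons[symmetric])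

definition poly_eval_at :: "(nat \<Rightarrow> rat poly) \<Rightarrow> complex mpoly \<Rightarrow> rat poly" where
  "poly_eval_at = coeff_eval (\<lambda>c. [:rat_of_complex c:])"

definition ratfun_eval_at :: "(nat \<Rightarrow> ratfun) \<Rightarrow> complex mpoly \<Rightarrow> ratfun" where
  "ratfun_eval_at = coeff_eval (\<lambda>c. ratfun_const (rat_of_complex c))"

lemma ratfun_eval_at_to_fract:
  "ratfun_eval_at (\<lambda>i. to_fract (W i)) F = to_fract (poly_eval_at W F)"
  unfolding ratfun_eval_at_def poly_eval_at_def ratfun_const_def
  by (rule coeff_eval_hom[symmetric]) auto

text \<open>Specializing z is a ring homomorphism. Through this lemma, equations satisfied over
  \<open>\<rat>[z]\<close> yield complex points for every value of z.\<close>

lemma rat_poly_eval_poly_eval_at: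
  assumes "has_coeffs_in \<rat> F"
  shows "rat_poly_eval (poly_eval_at W F) z = mpoly_eval (\<lambda>i. rat_poly_eval (W i) z) F"
  unfolding mpoly_eval_eq_coeff_eval_rat[OF assms] poly_eval_at_def
  by (subst coeff_eval_hom[of "\<lambda>p. rat_poly_eval p z"])
    (auto simp: rat_poly_eval_add rat_poly_eval_mult)

text \<open>The same rational number \<open>r\<close> governs both readings, so equations and
  inequations at rational points pass between the complex numbers and
  \<open>\<rat>(z)\<close>.\<close>

lemma ratfun_eval_at_const:
  assumes "has_coeffs_in \<rat> F"
  obtains r where "ratfun_eval_at (\<lambda>i. ratfun_const (q i)) F = ratfun_const r"
    "mpoly_eval (\<lambda>i. of_rat (q i)) F = of_rat r"
proof
  show "ratfun_eval_at (\<lambda>i. ratfun_const (q i)) F = ratfun_const (coeff_eval rat_of_complex q F)"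
    unfolding ratfun_eval_at_def
    by (rule coeff_eval_hom[symmetric]) (auto simp: ratfun_const_add ratfun_const_mult)
  show "mpoly_eval (\<lambda>i. of_rat (q i)) F = of_rat (coeff_eval rat_of_complex q F)"
    unfolding mpoly_eval_eq_coeff_eval_rat[OF assms]
    by (rule coeff_eval_hom[symmetric]) (auto simp: of_rat_add of_rat_mult)
qed

lemma mpoly_eval_in_Rats:
  assumes "has_coeffs_in \<rat> F" "\<And>i. v i \<in> \<rat>"
  shows "mpoly_eval v F \<in> (\<rat> :: complex set)"
proof -
  obtain r where "mpoly_eval (\<lambda>i. of_rat (rat_of_complex (v i))) F = of_rat r"
    using ratfun_eval_at_const[OF assms(1), of "\<lambda>i. rat_of_complex (v i)"] by metis
  then show ?thesis using assms(2) by (simp add: of_rat_rat_of_complex)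
qed

section \<open>Projective points and finitely many charts\<close>

lemma proj_pt_self: "v \<in> proj_pt v"
  unfolding proj_pt_def by (rule CollectI) (rule exI[of _ 1], simp)

lemma proj_pt_scale: "c \<noteq> 0 \<Longrightarrow> proj_pt (\<lambda>i. c * v i) = proj_pt v"
proof -
  assume c: "c \<noteq> 0"
  have "(\<lambda>i. d * v i) \<in> proj_pt (\<lambda>i. c * v i)" if "d \<noteq> 0" for d
    unfolding proj_pt_def using c that
    by (intro CollectI exI[of _ "d / c"]) (auto simp: fun_eq_iff)
  moreover have "(\<lambda>i. d * (c * v i)) \<in> proj_pt v" if "d \<noteq> 0" for d
    unfolding proj_pt_def using c that
    by (intro CollectI exI[of _ "d * c"]) (auto simp: fun_eq_iff)
  ultimately show ?thesis unfolding proj_pt_def by blast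
qed

lemma proj_space_mem:
  assumes "P \<in> proj_space N" "v \<in> P"
  shows "P = proj_pt v" "v \<in> cvec N" "\<exists>i. v i \<noteq> 0" "\<exists>i\<le>N. v i \<noteq> 0"
proof -
  obtain u where u: "u \<in> cvec N" "\<exists>i. u i \<noteq> 0" "P = proj_pt u"
    using assms(1) unfolding proj_space_def by blast
  then obtain c where c: "c \<noteq> 0" "v = (\<lambda>i. c * u i)"
    using assms(2) unfolding proj_pt_def by blast
  show "P = proj_pt v" using u(3) c proj_pt_scale by simp
  show "v \<in> cvec N" using u(1) c by (simp add: cvec_def)
  show "\<exists>i. v i \<noteq> 0" using u(2) c by simp
  then show "\<exists>i\<le>N. v i \<noteq> 0" using \<open>v \<in> cvec N\<close> unfolding cvec_def by (metis (mono_tags) mem_Collect_eq not_le)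
qed

lemma proj_pt_in_proj_space: "v \<in> cvec N \<Longrightarrow> v i \<noteq> 0 \<Longrightarrow> proj_pt v \<in> proj_space N"
  unfolding proj_space_def by blast

text \<open>Nonzero vectors whose 2x2 minors all vanish are proportional. Minors express
  distinctness of points by polynomials, and indices up to \<open>N\<close> keep the choice
  finite.\<close>

lemma proj_pt_inj_minor:
  assumes "proj_pt u \<noteq> proj_pt v" "u \<in> cvec N" "v \<in> cvec N" "u i \<noteq> 0" "v j \<noteq> 0"
  shows "\<exists>a\<le>N. \<exists>b\<le>N. u a * v b \<noteq> u b * v a"
proof (rule ccontr)
  assume "\<not> ?thesis"
  then have *: "u a * v b = u b * v a" for a b
  proof (cases "a \<le> N \<and> b \<le> N")
    case False
    then show ?thesis using assms(2,3) unfolding cvec_def by (auto simp: not_le)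
  qed auto
  have "u j \<noteq> 0" using *[of i j] assms(4,5) by auto
  have "u = (\<lambda>a. (u j / v j) * v a)"
    using *[of _ j] assms(5) by (auto simp: fun_eq_iff field_simps)
  then have "proj_pt u = proj_pt v"
    using proj_pt_scale[of "u j / v j" v] assms(5) \<open>u j \<noteq> 0\<close> by simp
  with assms(1) show False by simp
qed

lemma minor_eq_if_proj_pt_eq:
  assumes "proj_pt u = proj_pt v"
  shows "u a * v b = u b * v a"
proof -
  obtain c where "u = (\<lambda>i. c * v i)"
    using proj_pt_self[of u] assms unfolding proj_pt_def by auto
  then show ?thesis by simp
qed

text \<open>Compared with \<open>local_rep\<close>, the open set where \<open>G\<close> does not
  vanish is named and the base point is dropped, so that one chart can serve many points.\<close>

definition rational_chart ::
  "point set \<Rightarrow> (point \<Rightarrow> point) \<Rightarrow> complex mpoly \<Rightarrow> (nat \<Rightarrow> complex mpoly) \<Rightarrow> bool" where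
  "rational_chart X \<pi> G F \<longleftrightarrow> has_coeffs_in \<rat> G \<and> (\<exists>e. homogeneous e G) \<and>
     (\<forall>i. has_coeffs_in \<rat> (F i)) \<and> (\<exists>d. \<forall>i. homogeneous d (F i)) \<and>
     (\<forall>Q\<in>X. \<forall>v\<in>Q. mpoly_eval v G \<noteq> 0 \<longrightarrow> \<pi> Q = proj_pt (\<lambda>i. mpoly_eval v (F i)))"

lemma ex_rational_chart:
  assumes "morphism \<rat> X Y \<pi>" "P \<in> X"
  shows "\<exists>G F. rational_chart X \<pi> G F \<and> (\<forall>v\<in>P. mpoly_eval v G \<noteq> 0)"
proof -
  obtain F where F: "local_rep \<rat> X \<pi> P F" using assms unfolding morphism_def by blast
  then obtain G e where "homogeneous e G" "has_coeffs_in \<rat> G" "\<forall>v\<in>P. mpoly_eval v G \<noteq> 0"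
    "\<forall>Q\<in>X. \<forall>v\<in>Q. mpoly_eval v G \<noteq> 0 \<longrightarrow> \<pi> Q = proj_pt (\<lambda>i. mpoly_eval v (F i))"
    unfolding local_rep_def by blast
  moreover have "\<exists>d. \<forall>i. homogeneous d (F i)" "\<forall>i. has_coeffs_in \<rat> (F i)"
    using F unfolding local_rep_def by auto
  ultimately have "rational_chart X \<pi> G F" unfolding rational_chart_def by blast
  with \<open>\<forall>v\<in>P. mpoly_eval v G \<noteq> 0\<close> show ?thesis by blast
qed

lemma continuous_on_mpoly_eval:
  fixes v :: "'x::topological_space \<Rightarrow> nat \<Rightarrow> complex"
  assumes "\<And>i. continuous_on A (\<lambda>x. v x i)"
  shows "continuous_on A (\<lambda>x. mpoly_eval (v x) F)"
  unfolding mpoly_eval_def by (intro continuous_intros assms)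

text \<open>The normalised coordinate vectors of the points of \<open>X\<close> form a compact set in the Euclidean
  topology, which replaces an appeal to Hilbert's basis theorem.\<close>

lemma finite_rational_charts:
  assumes "proj_closed k N X" "morphism \<rat> X Y \<pi>"
  shows "\<exists>K. finite K \<and> (\<forall>(G, F)\<in>K. rational_chart X \<pi> G F) \<and>
     (\<forall>P\<in>X. \<forall>v\<in>P. \<exists>(G, F)\<in>K. mpoly_eval v G \<noteq> 0)"
proof -
  obtain S where S: "finite S" "\<forall>F\<in>S. has_coeffs_in k F \<and> (\<exists>d. homogeneous d F)"
    "X = {P \<in> proj_space N. \<forall>F\<in>S. \<forall>v\<in>P. mpoly_eval v F = 0}"
    using assms(1) unfolding proj_closed_def by blast
  \<comment> \<open>A product of closed unit discs and singletons, compact by Tychonoff's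
    theorem.\<close>
  define B :: "(nat \<Rightarrow> complex) set"
    where "B = PiE UNIV (\<lambda>i. if i \<le> N then cball 0 1 else {0})"
  \<comment> \<open>Vectors on the cone over \<open>X\<close> scaled so that the largest coordinate
    norm is 1; this also keeps them away from the zero vector.\<close>
  define T where "T = B \<inter> ((\<Union>i\<le>N. {v. norm (v i) = 1}) \<inter> (\<Inter>F\<in>S. {v. mpoly_eval v F = 0}))"
  have "compactin (product_topology (\<lambda>i. euclidean) UNIV) B"
    unfolding B_def compactin_PiE by auto
  then have "compact B" by (simp add: euclidean_product_topology)
  moreover have "closed {v :: nat \<Rightarrow> complex. norm (v i) = 1}" for i
    by (intro closed_Collect_eq continuous_intros continuous_on_product_coordinates)
  moreover have "closed {v :: nat \<Rightarrow> complex. mpoly_eval v F = 0}" for F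
    by (intro closed_Collect_eq continuous_on_mpoly_eval continuous_intros
        continuous_on_product_coordinates)
  ultimately have "compact T"
    unfolding T_def by (intro compact_Int_closed closed_Int closed_UN closed_INT) auto
  have B_iff: "v \<in> B \<longleftrightarrow> (\<forall>i\<le>N. norm (v i) \<le> 1) \<and> v \<in> cvec N" for v
    unfolding B_def cvec_def PiE_UNIV_domain by (auto simp: Pi_iff not_le split: if_splits)
  have T_iff: "v \<in> T \<longleftrightarrow> v \<in> B \<and> (\<exists>i\<le>N. norm (v i) = 1) \<and> (\<forall>F\<in>S. mpoly_eval v F = 0)" for v
    unfolding T_def by (simp add: Bex_def)
  have T_X: "proj_pt v \<in> X" if vT: "v \<in> T" for v
  proof -
    obtain i where i: "i \<le> N" "norm (v i) = 1" using T_iff[THEN iffD1, OF vT] by blast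
    have "v \<in> cvec N" using T_iff[THEN iffD1, OF vT] B_iff[of v] by blast
    with i have "proj_pt v \<in> proj_space N" by (intro proj_pt_in_proj_space[of v N i]) auto
    moreover have "mpoly_eval u F = 0" if F: "F \<in> S" and u: "u \<in> proj_pt v" for F u
    proof -
      obtain c where "u = (\<lambda>i. c * v i)" using u unfolding proj_pt_def by blast
      moreover obtain d where "homogeneous d F" using S(2) F by blast
      moreover have "mpoly_eval v F = 0" using T_iff[THEN iffD1, OF vT] F by blast
      ultimately show ?thesis by (simp add: mpoly_eval_scale)
    qed
    ultimately show ?thesis unfolding S(3) by blast
  qed
  have "\<exists>p. rational_chart X \<pi> (fst p) (snd p) \<and> mpoly_eval v (fst p) \<noteq> 0" if vT: "v \<in> T" for v
  proof -
    obtain G F where "rational_chart X \<pi> G F" "\<forall>u\<in>proj_pt v. mpoly_eval u G \<noteq> 0"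
      using ex_rational_chart[OF assms(2) T_X[OF vT]] by blast
    then show ?thesis using proj_pt_self[of v] by (intro exI[of _ "(G, F)"]) auto
  qed
  then obtain p where p: "\<forall>v\<in>T. rational_chart X \<pi> (fst (p v)) (snd (p v)) \<and>
      mpoly_eval v (fst (p v)) \<noteq> 0"
    by (rule bchoice[THEN exE, OF ballI])
  define g where "g v = fst (p v)" for v
  define f where "f v = snd (p v)" for v
  have gf: "\<And>v. v \<in> T \<Longrightarrow> rational_chart X \<pi> (g v) (f v)"
    "\<And>v. v \<in> T \<Longrightarrow> mpoly_eval v (g v) \<noteq> 0" using p unfolding g_def f_def by auto
  have opn: "open {v :: nat \<Rightarrow> complex. mpoly_eval v G \<noteq> 0}" for G
    by (intro open_Collect_neq continuous_on_mpoly_eval continuous_intros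
        continuous_on_product_coordinates)
  have cover: "T \<subseteq> (\<Union>u\<in>T. {v. mpoly_eval v (g u) \<noteq> 0})" using gf(2) by blast
  obtain T' where T': "T' \<subseteq> T" "finite T'" "T \<subseteq> (\<Union>u\<in>T'. {v. mpoly_eval v (g u) \<noteq> 0})"
    using compactE_image[OF \<open>compact T\<close> opn cover] .
  show ?thesis
  proof (intro exI[of _ "(\<lambda>u. (g u, f u)) ` T'"] conjI ballI)
    fix P v assume P: "P \<in> X" "v \<in> P"
    have Pv: "P \<in> proj_space N" using P(1) S(3) by simp
    note Pv = this proj_space_mem(2,1)[OF this P(2)]
    obtain j where j: "j \<le> N" "v j \<noteq> 0" using proj_space_mem(4)[OF Pv(1) P(2)] by blast
    \<comment> \<open>Dividing by the largest coordinate norm moves v into \<open>T\<close>;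
      homogeneity of the chart's \<open>G\<close> then carries its nonvanishing back to v.\<close>
    define M where "M = Max ((\<lambda>i. norm (v i)) ` {..N})"
    have "M \<in> (\<lambda>i. norm (v i)) ` {..N}" unfolding M_def by (intro Max_in) auto
    then obtain i where i: "i \<le> N" "M = norm (v i)" by auto
    have le: "norm (v l) \<le> M" if "l \<le> N" for l unfolding M_def using that by (intro Max_ge) auto
    have "M > 0" using le[OF j(1)] j(2) by (smt (verit) zero_less_norm_iff)
    define u where "u = (\<lambda>l. of_real (1 / M) * v l)"
    have "u \<in> B" using le \<open>M > 0\<close> Pv(2) unfolding B_iff u_def cvec_def
      by (auto simp: norm_mult norm_divide)
    moreover have "norm (u i) = 1" using i \<open>M > 0\<close> by (simp add: u_def norm_mult norm_divide)
    moreover have "u \<in> proj_pt v" unfolding u_def proj_pt_def using \<open>M > 0\<close>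
      by (intro CollectI exI[of _ "of_real (1 / M)"]) auto
    then have "u \<in> P" using Pv(3) by simp
    then have "mpoly_eval u F = 0" if "F \<in> S" for F using P(1) that unfolding S(3) by blast
    ultimately have "u \<in> T" using i(1) T_iff[of u] by blast
    then obtain w where w: "w \<in> T'" "mpoly_eval u (g w) \<noteq> 0" using T'(3) by blast
    then obtain e where e: "homogeneous e (g w)"
      using gf(1)[of w] T'(1) unfolding rational_chart_def by blast
    have "mpoly_eval v (g w) \<noteq> 0"
      using w(2) mpoly_eval_scale[OF e, of "of_real (1 / M)" v] unfolding u_def by auto
    then show "\<exists>(G, F)\<in>(\<lambda>u. (g u, f u)) ` T'. mpoly_eval v G \<noteq> 0"
      using w(1) by (intro bexI[of _ "(g w, f w)"]) auto
  next
    fix p assume "p \<in> (\<lambda>u. (g u, f u)) ` T'"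
    then obtain u where "u \<in> T'" "p = (g u, f u)" by blast
    then show "case p of (G, F) \<Rightarrow> rational_chart X \<pi> G F"
      using gf(1)[of u] T'(1) by auto
  next
    show "finite ((\<lambda>u. (g u, f u)) ` T')" using T'(2) by simp
  qed
qed

section \<open>Rational curves from polynomial vectors\<close>

text \<open>Scaling multiplies the value of a homogeneous equation by a power of the factor, so one
  nonzero representative decides membership.\<close>

lemma proj_closed_equations:
  assumes "proj_closed k N X"
  shows "\<exists>S. finite S \<and> (\<forall>F\<in>S. has_coeffs_in k F \<and> (\<exists>d. homogeneous d F)) \<and>
    X \<subseteq> proj_space N \<and>
    (\<forall>u i. u \<in> cvec N \<longrightarrow> u i \<noteq> 0 \<longrightarrow> (proj_pt u \<in> X \<longleftrightarrow> (\<forall>F\<in>S. mpoly_eval u F = 0)))"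
proof -
  obtain S where S: "finite S" "\<forall>F\<in>S. has_coeffs_in k F \<and> (\<exists>d. homogeneous d F)"
    "X = {P \<in> proj_space N. \<forall>F\<in>S. \<forall>v\<in>P. mpoly_eval v F = 0}"
    using assms unfolding proj_closed_def by blast
  have "proj_pt u \<in> X \<longleftrightarrow> (\<forall>F\<in>S. mpoly_eval u F = 0)" if u: "u \<in> cvec N" "u i \<noteq> 0" for u i
  proof
    assume "proj_pt u \<in> X"
    then show "\<forall>F\<in>S. mpoly_eval u F = 0" using S(3) proj_pt_self by blast
  next
    assume *: "\<forall>F\<in>S. mpoly_eval u F = 0"
    have "mpoly_eval v F = 0" if F: "F \<in> S" and v: "v \<in> proj_pt u" for F v
    proof -
      obtain c where "v = (\<lambda>i. c * u i)" using v unfolding proj_pt_def by blast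
      moreover obtain d where "homogeneous d F" using S(2) F by blast
      ultimately show ?thesis using * F by (simp add: mpoly_eval_scale)
    qed
    then show "proj_pt u \<in> X" unfolding S(3) using proj_pt_in_proj_space[OF u] by blast
  qed
  then show ?thesis using S(1,2) unfolding S(3) by (intro exI[of _ S]) auto
qed

lemma line_pt_in_proj_line: "(x, y) \<noteq> (0, 0) \<Longrightarrow> line_pt x y \<in> proj_line"
  unfolding line_pt_def
  by (rule proj_pt_in_proj_space[of _ _ "if x = 0 then 1 else 0"]) (auto simp: cvec_def)

lemma proj_line_cases:
  assumes "Q \<in> proj_line"
  obtains z where "Q = line_pt z 1" | "Q = line_pt 1 0"
proof -
  obtain v where v: "v \<in> cvec 1" "Q = proj_pt v" "\<exists>i. v i \<noteq> 0"
    using assms unfolding proj_space_def by blast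
  have v2: "v i = 0" if "i \<noteq> 0" "i \<noteq> 1" for i using v(1) that unfolding cvec_def by auto
  show thesis
  proof (cases "v 1 = 0")
    case False
    have "v = (\<lambda>i. v 1 * (if i = 0 then v 0 / v 1 else if i = 1 then 1 else 0))"
      using False v2 by (auto simp: fun_eq_iff)
    then have "Q = line_pt (v 0 / v 1) 1"
      unfolding v(2) line_pt_def using proj_pt_scale[OF False] by metis
    then show thesis using that by blast
  next
    case True
    then have "v 0 \<noteq> 0" using v(3) v2 by metis
    moreover have "v = (\<lambda>i. v 0 * (if i = 0 then 1 else if i = 1 then 0 else 0))"
      using True v2 by (auto simp: fun_eq_iff)
    ultimately have "Q = line_pt 1 0"
      unfolding v(2) line_pt_def using proj_pt_scale[of "v 0"] by metis
    then show thesis using that by blast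
  qed
qed

text \<open>Nonempty open sets of complex numbers are infinite. This extends the equations of a
  variety along a curve to the parameters where the given formula degenerates.\<close>

lemma continuous_eq_0_if_cofinite:
  fixes f :: "complex \<Rightarrow> complex"
  assumes "continuous_on UNIV f" "finite E" "\<And>z. z \<notin> E \<Longrightarrow> f z = 0"
  shows "f z = 0"
proof -
  have "open {z. f z \<noteq> 0}"
    by (intro open_Collect_neq assms(1) continuous_on_const)
  moreover have "finite {z. f z \<noteq> 0}"
    by (rule finite_subset[OF _ assms(2)]) (use assms(3) in auto)
  ultimately have "{z. f z \<noteq> 0} = {}"
    using finite_imp_not_open by blast
  then show ?thesis by blast
qed

text \<open>Take a common divisor \<open>g\<close> of greatest degree, bounded by the degree of
  \<open>W j\<close>. A common root z of the quotients would allow \<open>g\<close> to be enlarged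
  by the factor \<open>[:-z, 1:]\<close>.\<close>

lemma remove_common_roots:
  fixes W :: "nat \<Rightarrow> complex poly"
  assumes "W j \<noteq> 0"
  shows "\<exists>g V. g \<noteq> 0 \<and> (\<forall>i. W i = g * V i) \<and> (\<forall>z. \<exists>i. poly (V i) z \<noteq> 0)"
proof -
  let ?P = "\<lambda>g. g \<noteq> 0 \<and> (\<forall>i. g dvd W i)"
  have "\<exists>g. ?P g \<and> (\<forall>h. ?P h \<longrightarrow> degree h \<le> degree g)"
    using assms by (intro ex_has_greatest_nat[of ?P 1 degree "Suc (degree (W j))"])
      (auto simp: less_Suc_eq_le intro!: dvd_imp_degree_le[OF _ assms])
  then obtain g where g: "?P g" "\<And>h. ?P h \<Longrightarrow> degree h \<le> degree g" by blast
  then have "\<forall>i. \<exists>v. W i = g * v" unfolding dvd_def by blast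
  then obtain V where V: "\<And>i. W i = g * V i" by metis
  have "\<exists>i. poly (V i) z \<noteq> 0" for z
  proof (rule ccontr)
    assume "\<not> ?thesis"
    then have "[:-z, 1:] dvd V i" for i by (simp add: poly_eq_0_iff_dvd[symmetric])
    then have "g * [:-z, 1:] dvd W i" for i unfolding V by (rule mult_dvd_mono[OF dvd_refl])
    moreover have "g * [:-z, 1:] \<noteq> 0" using g(1) by (intro no_zero_divisors) auto
    ultimately have "degree (g * [:-z, 1:]) \<le> degree g" using g(2) by blast
    moreover have "degree (g * [:-z, 1:]) = degree g + 1"
      using g(1) by (subst degree_mult_eq) auto
    ultimately show False by simp
  qed
  with g(1) V show ?thesis by blast
qed

text \<open>\<open>D\<close> may exceed the degree of p: all coordinates of a map must become forms
  of one common degree.\<close>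

definition homogenize :: "nat \<Rightarrow> complex poly \<Rightarrow> complex mpoly" where
  "homogenize D p = (\<Sum>k\<le>D. Poly_Mapping.single
     (Poly_Mapping.single 0 k + Poly_Mapping.single 1 (D - k)) (Polynomial.coeff p k))"

lemma mpoly_eval_homogenize:
  "mpoly_eval v (homogenize D p) = (\<Sum>k\<le>D. Polynomial.coeff p k * v 0 ^ k * v 1 ^ (D - k))"
proof -
  have "mpoly_eval v (Poly_Mapping.single
     (Poly_Mapping.single 0 k + Poly_Mapping.single 1 (D - k)) (Polynomial.coeff p k)) =
     Polynomial.coeff p k * v 0 ^ k * v 1 ^ (D - k)" for k
    unfolding mpoly_eval_single monomial_eval_add by simp
  then show ?thesis unfolding homogenize_def mpoly_eval_sum by simp
qed

lemma homogeneous_homogenize: "homogeneous D (homogenize D p)"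
  unfolding homogeneous_def
proof
  fix e assume "e \<in> Poly_Mapping.keys (homogenize D p)"
  then have "e \<in> (\<Union>k\<le>D. Poly_Mapping.keys (Poly_Mapping.single
     (Poly_Mapping.single 0 k + Poly_Mapping.single (1::nat) (D - k)) (Polynomial.coeff p k)))"
    unfolding homogenize_def using keys_sum by fast
  then obtain k where k: "k \<le> D"
    "e = Poly_Mapping.single 0 k + Poly_Mapping.single (1::nat) (D - k)"
    by (auto split: if_splits)
  have "(\<Sum>i\<in>Poly_Mapping.keys e. Poly_Mapping.lookup e i) =
      (\<Sum>i\<in>{0, 1}. Poly_Mapping.lookup e i)"
    using Poly_Mapping.keys_add[of "Poly_Mapping.single 0 k" "Poly_Mapping.single (1::nat) (D - k)"] k(2)
    by (intro sum.mono_neutral_left) (auto simp: in_keys_iff split: if_splits)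
  also have "\<dots> = D" using k by (simp add: lookup_add lookup_single)
  finally show "(\<Sum>i\<in>Poly_Mapping.keys e. Poly_Mapping.lookup e i) = D" .
qed

lemma homogenize_eval_affine:
  assumes "degree p \<le> D" "v 1 \<noteq> 0"
  shows "mpoly_eval v (homogenize D p) = v 1 ^ D * poly p (v 0 / v 1)"
proof -
  have "v 1 ^ D * poly p (v 0 / v 1) = v 1 ^ D * (\<Sum>k\<le>D. Polynomial.coeff p k * (v 0 / v 1) ^ k)"
    using assms(1) poly_altdef[of p "v 0 / v 1"]
    by (simp add: sum.mono_neutral_left[of "{..D}" "{..degree p}"] coeff_eq_0)
  also have "\<dots> = (\<Sum>k\<le>D. Polynomial.coeff p k * v 0 ^ k * v 1 ^ (D - k))"
    unfolding sum_distrib_left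
    by (rule sum.cong) (use assms(2) in \<open>auto simp: field_simps power_diff\<close>)
  finally show ?thesis unfolding mpoly_eval_homogenize ..
qed

lemma homogenize_eval_infinity:
  assumes "v 1 = 0"
  shows "mpoly_eval v (homogenize D p) = Polynomial.coeff p D * v 0 ^ D"
proof -
  have "Polynomial.coeff p k * v 0 ^ k * v 1 ^ (D - k) = 0" if "k \<in> {..D} - {D}" for k
    using that assms by simp
  then have "(\<Sum>k\<in>{D}. Polynomial.coeff p k * v 0 ^ k * v 1 ^ (D - k)) = mpoly_eval v (homogenize D p)"
    unfolding mpoly_eval_homogenize by (intro sum.mono_neutral_left) auto
  then show ?thesis by simp
qed

text \<open>The vector \<open>W\<close> gives no point where all its entries vanish. Dividing by the
  common factor repairs this on the affine line, and homogenizing to the largest degree extends the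
  map to infinity. The image stays in \<open>X\<close> by continuity.\<close>

lemma polynomial_vector_morphism:
  fixes W :: "nat \<Rightarrow> complex poly"
  assumes X: "proj_closed k N X" and WN: "\<And>i. i > N \<Longrightarrow> W i = 0" and "W j \<noteq> 0"
    and WX: "\<And>z i. poly (W i) z \<noteq> 0 \<Longrightarrow> proj_pt (\<lambda>i. poly (W i) z) \<in> X"
  shows "\<exists>f. morphism UNIV proj_line X f \<and>
    (\<forall>z i. poly (W i) z \<noteq> 0 \<longrightarrow> f (line_pt z 1) = proj_pt (\<lambda>i. poly (W i) z))"
proof -
  obtain S where S: "finite S" "\<forall>F\<in>S. has_coeffs_in k F \<and> (\<exists>d. homogeneous d F)"
    "X \<subseteq> proj_space N" "\<forall>u i. u \<in> cvec N \<longrightarrow> u i \<noteq> 0 \<longrightarrow>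
      (proj_pt u \<in> X \<longleftrightarrow> (\<forall>F\<in>S. mpoly_eval u F = 0))"
    using proj_closed_equations[OF X] by (elim exE conjE) (rule that; assumption)
  have hom: "\<exists>d. homogeneous d F" if "F \<in> S" for F using S(2) that by blast
  obtain g V where gV: "g \<noteq> 0" "\<forall>i. W i = g * V i" "\<forall>z. \<exists>i. poly (V i) z \<noteq> 0"
    using remove_common_roots[of W j, OF \<open>W j \<noteq> 0\<close>] by (elim exE conjE) (rule that; assumption)
  have VN: "V i = 0" if "i > N" for i using gV(1) gV(2)[rule_format, of i] WN[OF that] by simp
  define D where "D = Max ((\<lambda>i. degree (V i)) ` {..N})"
  have deg: "degree (V i) \<le> D" for i
    unfolding D_def by (cases "i \<le> N") (auto simp: VN not_le)
  \<comment> \<open>Some component attains degree \<open>D\<close>, which makes the vector nonzero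
    at infinity. For \<open>D = 0\<close> the components are constants and a nonzero value at 0 is
    used instead.\<close>
  have lead: "\<exists>i. Polynomial.coeff (V i) D \<noteq> 0"
  proof (cases "D = 0")
    case True
    obtain i where "poly (V i) 0 \<noteq> 0" using gV(3) by blast
    then show ?thesis using True by (auto simp: poly_0_coeff_0)
  next
    case False
    have "D \<in> (\<lambda>i. degree (V i)) ` {..N}" unfolding D_def by (intro Max_in) auto
    then obtain i where "D = degree (V i)" by blast
    then show ?thesis using False by (metis degree_0 leading_coeff_0_iff)
  qed
  define h where "h v i = mpoly_eval v (homogenize D (V i))" for v i
  have h_affine: "h v i = v 1 ^ D * poly (V i) (v 0 / v 1)" if "v 1 \<noteq> 0" for v i
    unfolding h_def using homogenize_eval_affine[of "V i" D v] deg that by blast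
  have h_cvec: "h v \<in> cvec N" for v
    unfolding cvec_def h_def mpoly_eval_homogenize by (simp add: VN)
  have h_scale: "h (\<lambda>i. c * v i) i = c ^ D * h v i" for c v i
    unfolding h_def by (rule mpoly_eval_scale[OF homogeneous_homogenize])
  have h_nz: "\<exists>i. h v i \<noteq> 0" if "v 0 \<noteq> 0 \<or> v 1 \<noteq> 0" for v
  proof (cases "v 1 = 0")
    case False
    then show ?thesis using h_affine[of v, OF False] gV(3) by auto
  next
    case True
    then show ?thesis using homogenize_eval_infinity[of v, OF True] lead that unfolding h_def by auto
  qed
  have V_S: "mpoly_eval (\<lambda>i. poly (V i) z) F = 0" if F: "F \<in> S" for z F
  proof (rule continuous_eq_0_if_cofinite[where E = "{z. poly g z = 0}"
        and f = "\<lambda>z. mpoly_eval (\<lambda>i. poly (V i) z) F"])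
    show "continuous_on UNIV (\<lambda>z. mpoly_eval (\<lambda>i. poly (V i) z) F)"
      by (intro continuous_on_mpoly_eval continuous_intros)
    show "finite {z. poly g z = 0}" using gV(1) by (rule poly_roots_finite)
    fix z assume "z \<notin> {z. poly g z = 0}"
    then have g0: "poly g z \<noteq> 0" by simp
    obtain i where i: "poly (V i) z \<noteq> 0" using gV(3) by blast
    have Wz: "poly (W i) z = poly g z * poly (V i) z" for i using gV(2) by simp
    have "proj_pt (\<lambda>i. poly (W i) z) \<in> X" using WX[of i z] i g0 Wz by simp
    then have "mpoly_eval (\<lambda>i. poly (W i) z) F = 0"
      using S(4)[rule_format, of "\<lambda>i. poly (W i) z" i] F i g0 Wz by (auto simp: cvec_def VN)
    moreover obtain d where "homogeneous d F" using hom F by blast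
    ultimately show "mpoly_eval (\<lambda>i. poly (V i) z) F = 0"
      using g0 unfolding Wz by (simp add: mpoly_eval_scale)
  qed
  have h_S_affine: "mpoly_eval (h v) F = 0" if F: "F \<in> S" and v: "v 1 \<noteq> 0" for v F
  proof -
    obtain d where "homogeneous d F" using hom F by blast
    moreover have "h v = (\<lambda>i. v 1 ^ D * poly (V i) (v 0 / v 1))" using h_affine[of v, OF v] by blast
    ultimately show ?thesis using V_S[OF F] by (simp add: mpoly_eval_scale)
  qed
  have h_S: "mpoly_eval (h v) F = 0" if F: "F \<in> S" for v F
  proof (cases "v 1 = 0")
    case True
    \<comment> \<open>Infinity is reached as the limit of the affine points whose second coordinate
      s tends to 0.\<close>
    let ?u = "\<lambda>s. v(1 := s)"
    have "mpoly_eval (h (?u 0)) F = 0"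
    proof (rule continuous_eq_0_if_cofinite[where E = "{0}"
        and f = "\<lambda>s. mpoly_eval (h (?u s)) F"])
      show "continuous_on UNIV (\<lambda>s. mpoly_eval (h (?u s)) F)"
        unfolding h_def mpoly_eval_homogenize
        by (intro continuous_on_mpoly_eval) (auto intro!: continuous_intros)
      show "mpoly_eval (h (?u s)) F = 0" if "s \<notin> {0}" for s
        by (rule h_S_affine[OF F, of "?u s"]) (use that in simp)
    qed simp
    then show ?thesis using True by (metis fun_upd_triv)
  qed (rule h_S_affine[of F v, OF F])
  \<comment> \<open>The choice of representative is harmless, since the forms share the degree
    \<open>D\<close>.\<close>
  define f where "f Q = proj_pt (h (SOME v. v \<in> Q))" for Q :: point
  have f_eq: "f Q = proj_pt (h v)" if Q: "Q \<in> proj_line" and v: "v \<in> Q" for Q v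
  proof -
    have "(SOME v. v \<in> Q) \<in> Q" using v by (rule someI[of "\<lambda>v. v \<in> Q"])
    then obtain c where c: "c \<noteq> 0" "(SOME v. v \<in> Q) = (\<lambda>i. c * v i)"
      using proj_space_mem(1)[OF Q v] unfolding proj_pt_def by blast
    have "h (\<lambda>i. c * v i) = (\<lambda>i. c ^ D * h v i)" using h_scale by blast
    then show ?thesis unfolding f_def c(2) using proj_pt_scale[of "c ^ D" "h v"] c(1) by simp
  qed
  have f_X: "f Q \<in> X" if Q: "Q \<in> proj_line" for Q
  proof -
    obtain v where v: "v \<in> Q" using Q proj_pt_self unfolding proj_space_def by blast
    obtain l where "l \<le> 1" "v l \<noteq> 0" using proj_space_mem(4)[OF Q v] by blast
    then have "v 0 \<noteq> 0 \<or> v 1 \<noteq> 0" by (cases l) auto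
    then obtain i where "h v i \<noteq> 0" using h_nz by blast
    then show ?thesis using S(4)[rule_format, OF h_cvec, of _ i] h_S f_eq[OF Q v] by simp
  qed
  \<comment> \<open>With \<open>1\<close> in the role of \<open>G\<close>, a single representation
    is valid on the whole line.\<close>
  have "homogeneous 0 (1 :: complex mpoly)"
    unfolding homogeneous_def by (simp add: single_one[symmetric] del: single_one)
  moreover have "mpoly_eval v 1 = (1 :: complex)" for v
    unfolding single_one[symmetric] mpoly_eval_single by simp
  ultimately have "local_rep UNIV proj_line f P (\<lambda>i. homogenize D (V i))" for P
    unfolding local_rep_def using homogeneous_homogenize f_eq
    by (intro conjI exI[of _ D] exI[of _ "1 :: complex mpoly"] exI[of _ "0 :: nat"])
      (auto simp: has_coeffs_in_def h_def[abs_def])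
  then have mor: "morphism UNIV proj_line X f" unfolding morphism_def using f_X by blast
  have "f (line_pt z 1) = proj_pt (\<lambda>i. poly (W i) z)" if W: "poly (W i) z \<noteq> 0" for z i
  proof -
    let ?v = "\<lambda>i. if i = 0 then z else if i = 1 then 1 else (0::complex)"
    have "f (line_pt z 1) = proj_pt (h ?v)"
      by (rule f_eq[OF line_pt_in_proj_line]) (auto simp: line_pt_def proj_pt_self)
    also have "h ?v = (\<lambda>i. poly (V i) z)" using h_affine[of ?v] by auto
    also have "proj_pt \<dots> = proj_pt (\<lambda>i. poly g z * poly (V i) z)"
      using W gV(2)[rule_format, of i] by (intro proj_pt_scale[symmetric]) auto
    also have "\<dots> = proj_pt (\<lambda>i. poly (W i) z)" using gV(2) by simp
    finally show ?thesis .
  qed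
  with mor show ?thesis by blast
qed

section \<open>Points of the surface over the field of rational functions\<close>

text \<open>One denominator serves all coordinates because only those up to \<open>N\<close> can be
  nonzero.\<close>

lemma clear_denominators:
  fixes v :: "nat \<Rightarrow> 'a::idom fract"
  assumes "\<And>i. i > N \<Longrightarrow> v i = 0"
  shows "\<exists>B W. B \<noteq> 0 \<and> (\<forall>i>N. W i = 0) \<and> (\<forall>i. v i = to_fract (W i) / to_fract B)"
proof -
  have "\<exists>p. snd p \<noteq> 0 \<and> v i = to_fract (fst p) / to_fract (snd p)" for i
  proof (cases "v i")
    case (Fract a b)
    then show ?thesis by (intro exI[of _ "(a, b)"]) (simp add: to_fract_def)
  qed
  then obtain p where p: "\<forall>i. snd (p i) \<noteq> 0 \<and> v i = to_fract (fst (p i)) / to_fract (snd (p i))"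
    by (rule choice[THEN exE, OF allI])
  define B where "B = (\<Prod>i\<le>N. snd (p i))"
  define W where "W i = (if i \<le> N then fst (p i) * (\<Prod>j\<in>{..N} - {i}. snd (p j)) else 0)" for i
  have "v i = to_fract (W i) / to_fract B" for i
  proof (cases "i \<le> N")
    case True
    let ?r = "\<Prod>j\<in>{..N} - {i}. snd (p j)"
    have "B = snd (p i) * ?r" unfolding B_def using True by (intro prod.remove) auto
    moreover have "?r \<noteq> 0" using p by (simp add: prod_zero_iff)
    moreover have "v i = to_fract (fst (p i)) / to_fract (snd (p i))" using p by blast
    ultimately show ?thesis unfolding W_def using True by simp
  qed (use assms in \<open>simp add: W_def\<close>)
  moreover have "B \<noteq> 0" unfolding B_def using p by (simp add: prod_zero_iff)
  moreover have "\<forall>i>N. W i = 0" unfolding W_def by simp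
  ultimately show ?thesis by blast
qed

lemma ratfun_cases:
  fixes s :: ratfun
  shows "\<exists>a b. b \<noteq> 0 \<and> s = to_fract a / to_fract b"
  by (cases s) (auto simp: to_fract_def)

text \<open>It makes y a - x b a nonzero polynomial; its roots will be the parameters of points over
  x / y.\<close>

lemma nonconstant_ratfun_independent:
  fixes x y :: complex
  assumes "to_fract a / to_fract b \<notin> range ratfun_const" "b \<noteq> 0"
    and eq: "Polynomial.smult y (map_poly of_rat a) = Polynomial.smult x (map_poly of_rat b)"
  shows "x = 0 \<and> y = 0"
proof (cases "y = 0")
  case True
  then show ?thesis using eq assms(2) by (simp add: smult_eq_0_iff)
next
  case False
  \<comment> \<open>For nonzero y, comparing coefficients at the degree of b shows that x / y is
    rational although x and y are complex; then a = q b makes the quotient constant.\<close>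
  define q where "q = Polynomial.coeff a (degree b) / Polynomial.coeff b (degree b)"
  have c: "y * of_rat (Polynomial.coeff a k) = x * of_rat (Polynomial.coeff b k)" for k
    using arg_cong[OF eq, of "\<lambda>p. Polynomial.coeff p k"] by (simp add: coeff_map_poly)
  have b0: "Polynomial.coeff b (degree b) \<noteq> 0" using assms(2) by simp
  have "x / y = of_rat q"
    using c[of "degree b"] False b0 unfolding q_def by (simp add: of_rat_divide field_simps)
  then have "(of_rat (Polynomial.coeff a k) :: complex) = of_rat (q * Polynomial.coeff b k)" for k
    using c[of k] False by (simp add: of_rat_mult field_simps)
  then have "a = [:q:] * b" by (intro poly_eqI) simp
  then have "to_fract a = ratfun_const q * to_fract b"
    unfolding ratfun_const_def by (simp only: to_fract_mult)
  then have "to_fract a / to_fract b = ratfun_const q"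
    using assms(2) by simp
  then show ?thesis using assms(1) by blast
qed

section \<open>The fibration with finitely many equations and charts over Q\<close>

text \<open>With \<open>S\<close> and \<open>K\<close> finite, lying on \<open>X\<close> and having
  a given image under \<open>\<pi>\<close> become finitely many polynomial conditions. The indices
  \<open>i0\<close>, \<open>i1\<close> choose between the standard coordinate of the line and its
  inverse.\<close>

locale charted_fibration =
  fixes N :: nat and X :: "point set" and \<pi> :: "point \<Rightarrow> point"
    and S :: "complex mpoly set" and K :: "(complex mpoly \<times> (nat \<Rightarrow> complex mpoly)) set"
    and i0 i1 :: nat
  assumes X_closed: "proj_closed \<rat> N X"
    and S_finite: "finite S"
    and S_coeffs: "F \<in> S \<Longrightarrow> has_coeffs_in \<rat> F"
    and S_hom: "F \<in> S \<Longrightarrow> \<exists>d. homogeneous d F"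
    and X_subset: "X \<subseteq> proj_space N"
    and X_iff: "u \<in> cvec N \<Longrightarrow> u i \<noteq> 0 \<Longrightarrow> proj_pt u \<in> X \<longleftrightarrow> (\<forall>F\<in>S. mpoly_eval u F = 0)"
    and pi_line: "P \<in> X \<Longrightarrow> \<pi> P \<in> proj_line"
    and K_finite: "finite K"
    and K_chart: "(G, H) \<in> K \<Longrightarrow> rational_chart X \<pi> G H"
    and K_cover: "P \<in> X \<Longrightarrow> u \<in> P \<Longrightarrow> \<exists>G H. (G, H) \<in> K \<and> mpoly_eval u G \<noteq> 0"
    and idx: "i0 = 0 \<and> i1 = 1 \<or> i0 = 1 \<and> i1 = 0"
begin

text \<open>The point \<open>\<pi> P\<close> has coordinate \<open>x / y\<close>, where the coordinate on the line is the
  \<open>i0\<close>-th homogeneous coordinate divided by the \<open>i1\<close>-th.\<close>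

definition over :: "point \<Rightarrow> complex \<Rightarrow> complex \<Rightarrow> bool" where
  "over P x y \<longleftrightarrow> (\<exists>u\<in>\<pi> P. u i0 * y = u i1 * x)"

lemma pi_coord_nonzero:
  assumes "P \<in> X" "u \<in> \<pi> P"
  shows "u i0 \<noteq> 0 \<or> u i1 \<noteq> 0"
proof -
  obtain l where "l \<le> 1" "u l \<noteq> 0"
    using proj_space_mem(4)[OF pi_line[OF assms(1)] assms(2)] by blast
  then show ?thesis using idx by (cases l) auto
qed

lemma over_all:
  assumes "P \<in> X" "over P x y" "u \<in> \<pi> P"
  shows "u i0 * y = u i1 * x"
proof -
  obtain w where w: "w \<in> \<pi> P" "w i0 * y = w i1 * x" using assms(2) unfolding over_def by blast
  then have "\<pi> P = proj_pt w" using proj_space_mem(1)[OF pi_line[OF assms(1)]] by blast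
  then obtain c where "u = (\<lambda>i. c * w i)" using assms(3) unfolding proj_pt_def by blast
  then show ?thesis using w(2) by simp
qed

lemma pi_nonempty:
  assumes "P \<in> X"
  obtains u where "u \<in> \<pi> P"
  using pi_line[OF assms] proj_pt_self unfolding proj_space_def by blast

lemma over_unique:
  assumes "P \<in> X" "over P x y" "over P x' y'"
  shows "y' * x = x' * y"
proof -
  obtain u where u: "u \<in> \<pi> P" using pi_nonempty[OF assms(1)] .
  have e: "u i0 * y = u i1 * x" "u i0 * y' = u i1 * x'"
    by (rule over_all[OF assms(1) assms(2) u], rule over_all[OF assms(1) assms(3) u])
  \<comment> \<open>The claim is tested after multiplication by each of \<open>u i0\<close> and
    \<open>u i1\<close>, one of which is nonzero.\<close>
  have a: "u i0 * (y' * x) = x * (u i1 * x')" unfolding e(2)[symmetric] by simp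
  have b: "u i0 * (x' * y) = x' * (u i1 * x)" unfolding e(1)[symmetric] by simp
  have c: "u i1 * (y' * x) = y' * (u i0 * y)" unfolding e(1) by simp
  have d: "u i1 * (x' * y) = y * (u i0 * y')" unfolding e(2) by simp
  have "u i0 * (y' * x) = u i0 * (x' * y)" unfolding a b by (simp add: ac_simps)
  moreover have "u i1 * (y' * x) = u i1 * (x' * y)" unfolding c d by (simp add: ac_simps)
  ultimately show ?thesis using pi_coord_nonzero[OF assms(1) u] by auto
qed

text \<open>These are the homogeneous coordinate vectors over \<open>\<rat>(z)\<close> of points
  lying over s; one chart defined at the point is enough. Excluding the zero vector is left to the
  places of use.\<close>

definition ratfun_solution :: "(nat \<Rightarrow> ratfun) \<Rightarrow> ratfun \<Rightarrow> bool" where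
  "ratfun_solution v s \<longleftrightarrow> (\<forall>F\<in>S. ratfun_eval_at v F = 0) \<and>
     (\<exists>(G, H)\<in>K. ratfun_eval_at v G \<noteq> 0 \<and>
        ratfun_eval_at v (H i0) = s * ratfun_eval_at v (H i1))"

text \<open>Homogeneity pulls the common denominator out, so vanishing over \<open>\<rat>(z)\<close>
  can be decided in \<open>\<rat>[z]\<close>.\<close>

lemma ratfun_eval_at_cleared:
  assumes "\<And>i. v i = to_fract (W i) / to_fract B" "homogeneous d F"
  shows "ratfun_eval_at v F = inverse (to_fract B) ^ d * to_fract (poly_eval_at W F)"
proof -
  have "v = (\<lambda>i. inverse (to_fract B) * to_fract (W i))"
    using assms(1) by (auto simp: fun_eq_iff field_simps)
  then show ?thesis
    using ratfun_eval_at_to_fract[of W F]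
    unfolding ratfun_eval_at_def by (simp add: coeff_eval_scale[OF assms(2)])
qed

lemma solution_specializes_to_X:
  assumes sol: "ratfun_solution v s" and "B \<noteq> 0" and WN: "\<forall>i>N. W i = 0"
    and vW: "\<And>i. v i = to_fract (W i) / to_fract B"
    and nz: "rat_poly_eval (W i) z \<noteq> 0"
  shows "proj_pt (\<lambda>i. rat_poly_eval (W i) z) \<in> X"
proof -
  have "mpoly_eval (\<lambda>i. rat_poly_eval (W i) z) F = 0" if F: "F \<in> S" for F
  proof -
    obtain d where "homogeneous d F" using S_hom[OF F] by blast
    then have "poly_eval_at W F = 0"
      using sol F ratfun_eval_at_cleared[OF vW] \<open>B \<noteq> 0\<close> unfolding ratfun_solution_def by auto
    then show ?thesis using rat_poly_eval_poly_eval_at[OF S_coeffs[OF F], of W z] by simp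
  qed
  moreover have "(\<lambda>i. rat_poly_eval (W i) z) \<in> cvec N" using WN by (simp add: cvec_def)
  ultimately show ?thesis using X_iff[of "\<lambda>i. rat_poly_eval (W i) z" i] nz by blast
qed

text \<open>The chart that certifies the solution computes \<open>\<pi>\<close> at each z where its
  \<open>G\<close> does not vanish. Together with the zeros of \<open>W j\<close> this excludes
  finitely many z.\<close>

lemma solution_specializes_over:
  assumes sol: "ratfun_solution v s" and "B \<noteq> 0" "b \<noteq> 0" and WN: "\<forall>i>N. W i = 0"
    and vW: "\<And>i. v i = to_fract (W i) / to_fract B" and s: "s = to_fract a / to_fract b"
    and nz: "W j \<noteq> 0"
  shows "\<exists>E. finite E \<and> (\<forall>z. z \<notin> E \<longrightarrow> rat_poly_eval (W j) z \<noteq> 0 \<and>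
     over (proj_pt (\<lambda>i. rat_poly_eval (W i) z)) (rat_poly_eval a z) (rat_poly_eval b z))"
proof -
  obtain G H where GH: "(G, H) \<in> K" "ratfun_eval_at v G \<noteq> 0"
    "ratfun_eval_at v (H i0) = s * ratfun_eval_at v (H i1)"
    using sol unfolding ratfun_solution_def by blast
  note chart = K_chart[OF GH(1), unfolded rational_chart_def]
  obtain e where e: "homogeneous e G" using chart by blast
  obtain d where d: "\<forall>i. homogeneous d (H i)" using chart by blast
  have G0: "poly_eval_at W G \<noteq> 0" using GH(2) ratfun_eval_at_cleared[OF vW e] by auto
  have "to_fract (poly_eval_at W (H i0)) = s * to_fract (poly_eval_at W (H i1))"
    using GH(3) ratfun_eval_at_cleared[OF vW, of d "H i0"] ratfun_eval_at_cleared[OF vW, of d "H i1"]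
      d \<open>B \<noteq> 0\<close> by simp
  then have "to_fract (poly_eval_at W (H i0) * b) = to_fract (poly_eval_at W (H i1) * a)"
    unfolding s using \<open>b \<noteq> 0\<close> by (simp add: field_simps)
  then have eq: "poly_eval_at W (H i0) * b = poly_eval_at W (H i1) * a"
    unfolding to_fract_eq_iff .
  let ?E = "{z. rat_poly_eval (W j) z = 0} \<union> {z. rat_poly_eval (poly_eval_at W G) z = 0}"
  have "over (proj_pt (\<lambda>i. rat_poly_eval (W i) z)) (rat_poly_eval a z) (rat_poly_eval b z)"
    if z: "z \<notin> ?E" for z
  proof -
    let ?w = "\<lambda>i. rat_poly_eval (W i) z"
    have "rat_poly_eval (W j) z \<noteq> 0" using z by blast
    then have "proj_pt ?w \<in> X"
      by (rule solution_specializes_to_X[OF sol \<open>B \<noteq> 0\<close> WN vW])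
    moreover have "mpoly_eval ?w G \<noteq> 0"
      using z rat_poly_eval_poly_eval_at[of G W z] chart by simp
    ultimately have "\<pi> (proj_pt ?w) = proj_pt (\<lambda>i. mpoly_eval ?w (H i))"
      using chart proj_pt_self by blast
    then have "(\<lambda>i. mpoly_eval ?w (H i)) \<in> \<pi> (proj_pt ?w)" using proj_pt_self by simp
    moreover have "mpoly_eval ?w (H i0) * rat_poly_eval b z = mpoly_eval ?w (H i1) * rat_poly_eval a z"
      using arg_cong[OF eq, of "\<lambda>p. rat_poly_eval p z"] chart
      by (simp add: rat_poly_eval_mult rat_poly_eval_poly_eval_at)
    ultimately show ?thesis unfolding over_def
      by (intro bexI[of _ "\<lambda>i. mpoly_eval ?w (H i)"])
  qed
  moreover have "finite ?E" using nz G0 finite_rat_poly_eval_roots by simp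
  ultimately show ?thesis by (intro exI[of _ ?E]) blast
qed

text \<open>The pair (0, 0) is left out because every point of \<open>X\<close> would count as lying
  over it.\<close>

definition bounded_fibres :: "point set \<Rightarrow> nat \<Rightarrow> bool" where
  "bounded_fibres C d \<longleftrightarrow> (\<forall>x y. (x, y) \<noteq> (0, 0) \<longrightarrow>
     finite {P \<in> C. over P x y} \<and> card {P \<in> C. over P x y} \<le> d)"

text \<open>For all but finitely many z the point with parameter z lies over a(z) / b(z). If it also
  lies over x / y, then z is a root of y a - x b, which is nonzero since s is not constant. The same
  count of roots shows that the parametrization is not constant.\<close>

lemma solution_curve:
  assumes sol: "ratfun_solution v s" and "B \<noteq> 0" "b \<noteq> 0" and WN: "\<forall>i>N. W i = 0"
    and vW: "\<And>i. v i = to_fract (W i) / to_fract B" and s: "s = to_fract a / to_fract b"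
    and nz: "W j \<noteq> 0" and nonconst: "s \<notin> range ratfun_const"
  shows "\<exists>C d E. rational_curve_on X C \<and> bounded_fibres C d \<and> finite E \<and>
     (\<forall>z. z \<notin> E \<longrightarrow> proj_pt (\<lambda>i. rat_poly_eval (W i) z) \<in> C \<and>
       over (proj_pt (\<lambda>i. rat_poly_eval (W i) z)) (rat_poly_eval a z) (rat_poly_eval b z))"
proof -
  let ?w = "\<lambda>z i. rat_poly_eval (W i) z"
  let ?a = "map_poly of_rat a :: complex poly" and ?b = "map_poly of_rat b :: complex poly"
  obtain E where E: "finite E" "\<And>z. z \<notin> E \<Longrightarrow> ?w z j \<noteq> 0"
    "\<And>z. z \<notin> E \<Longrightarrow> over (proj_pt (?w z)) (rat_poly_eval a z) (rat_poly_eval b z)"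
    using solution_specializes_over[OF sol \<open>B \<noteq> 0\<close> \<open>b \<noteq> 0\<close> WN vW s nz] by blast
  have "\<exists>f. morphism UNIV proj_line X f \<and> (\<forall>z i. poly (map_poly of_rat (W i)) z \<noteq> 0 \<longrightarrow>
      f (line_pt z 1) = proj_pt (\<lambda>i. poly (map_poly of_rat (W i)) z))"
  proof (rule polynomial_vector_morphism[OF X_closed, of _ j])
    show "map_poly of_rat (W i) = (0 :: complex poly)" if "i > N" for i using WN that by simp
    show "map_poly of_rat (W j) \<noteq> (0 :: complex poly)" using nz by simp
    show "proj_pt (\<lambda>i. poly (map_poly of_rat (W i)) z) \<in> X"
      if "poly (map_poly of_rat (W i)) z \<noteq> 0" for z i
      using solution_specializes_to_X[OF sol \<open>B \<noteq> 0\<close> WN vW, of i z] that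
      unfolding rat_poly_eval_def by blast
  qed
  then obtain f where f: "morphism UNIV proj_line X f"
    "\<And>z i. ?w z i \<noteq> 0 \<Longrightarrow> f (line_pt z 1) = proj_pt (?w z)"
    unfolding rat_poly_eval_def by blast
  have fX: "f Q \<in> X" if "Q \<in> proj_line" for Q using f(1) that unfolding morphism_def by blast
  have fE: "f (line_pt z 1) = proj_pt (?w z)" if "z \<notin> E" for z using f(2)[OF E(2)[OF that]] .
  have line: "line_pt z 1 \<in> proj_line" for z by (rule line_pt_in_proj_line) simp
  have roots: "finite {z. poly (Polynomial.smult y ?a - Polynomial.smult x ?b) z = 0} \<and>
    card {z. poly (Polynomial.smult y ?a - Polynomial.smult x ?b) z = 0} \<le> degree a + degree b"
    if xy: "(x, y) \<noteq> (0, 0)" for x y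
  proof -
    have ne: "Polynomial.smult y ?a - Polynomial.smult x ?b \<noteq> 0"
      using nonconstant_ratfun_independent[of a b y x] nonconst \<open>b \<noteq> 0\<close> xy unfolding s by auto
    have "degree (Polynomial.smult y ?a - Polynomial.smult x ?b) \<le> degree a + degree b"
      by (intro degree_diff_le order.trans[OF degree_smult_le]) (simp_all add: degree_map_poly)
    then show ?thesis using card_poly_roots_bound[OF ne] poly_roots_finite[OF ne] by auto
  qed
  have over_root: "poly (Polynomial.smult y ?a - Polynomial.smult x ?b) z = 0"
    if z: "z \<notin> E" and o: "over (f (line_pt z 1)) x y" for x y z
    using over_unique[OF fX[OF line] o, of "rat_poly_eval a z" "rat_poly_eval b z"] E(3)[OF z] fE[OF z]
    by (simp add: rat_poly_eval_def algebra_simps)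
  \<comment> \<open>The summands account for the exceptional parameters, the roots of y a - x b, and
    the point at parameter infinity.\<close>
  have "bounded_fibres (f ` proj_line) (card E + (degree a + degree b) + 1)"
    unfolding bounded_fibres_def
  proof (intro allI impI)
    fix x y :: complex assume xy: "(x, y) \<noteq> (0, 0)"
    let ?R = "{z. poly (Polynomial.smult y ?a - Polynomial.smult x ?b) z = 0}"
    let ?U = "(\<lambda>z. f (line_pt z 1)) ` (E \<union> ?R) \<union> {f (line_pt 1 0)}"
    have sub: "{P \<in> f ` proj_line. over P x y} \<subseteq> ?U"
    proof clarify
      fix Q assume Q: "Q \<in> proj_line" "over (f Q) x y"
        "f Q \<notin> {}" "f Q \<notin> (\<lambda>z. f (line_pt z 1)) ` (E \<union> ?R)"
      show "f Q = f (line_pt 1 0)"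
        using Q(1)
      proof (rule proj_line_cases)
        fix z assume z: "Q = line_pt z 1"
        then have "z \<in> E \<union> ?R" using over_root Q(2) by blast
        then show ?thesis using Q(4) z by blast
      qed simp
    qed
    have fin: "finite (E \<union> ?R)" using E(1) roots[OF xy] by blast
    have "card ?U \<le> card ((\<lambda>z. f (line_pt z 1)) ` (E \<union> ?R)) + card {f (line_pt 1 0)}"
      by (rule card_Un_le)
    also have "\<dots> \<le> card (E \<union> ?R) + 1" using card_image_le[OF fin] by simp
    also have "\<dots> \<le> card E + (degree a + degree b) + 1"
      using card_Un_le[of E ?R] roots[OF xy] by linarith
    finally have "card ?U \<le> card E + (degree a + degree b) + 1" .
    moreover have "finite ?U" using fin by simp
    ultimately show "finite {P \<in> f ` proj_line. over P x y} \<and>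
        card {P \<in> f ` proj_line. over P x y} \<le> card E + (degree a + degree b) + 1"
      using finite_subset[OF sub] card_mono[OF _ sub] by (meson order.trans)
  qed
  moreover have "rational_curve_on X (f ` proj_line)"
  proof -
    have "\<exists>P\<in>proj_line. \<exists>Q\<in>proj_line. f P \<noteq> f Q"
    proof (rule ccontr)
      assume "\<not> ?thesis"
      then have const: "f P = f Q" if "P \<in> proj_line" "Q \<in> proj_line" for P Q using that by blast
      let ?P = "f (line_pt 0 1)"
      obtain u where u: "u \<in> \<pi> ?P" using pi_nonempty[OF fX[OF line]] .
      have "(u i0, u i1) \<noteq> (0, 0)" using pi_coord_nonzero[OF fX[OF line] u] by auto
      then have fin: "finite {z. poly (Polynomial.smult (u i1) ?a - Polynomial.smult (u i0) ?b) z = 0}"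
        using roots[of "u i0" "u i1"] by blast
      have "over (f (line_pt z 1)) (u i0) (u i1)" for z
      proof -
        have "f (line_pt z 1) = ?P" using const line by blast
        then show ?thesis unfolding over_def using u by (intro bexI[of _ u]) (auto simp: mult.commute)
      qed
      then have "UNIV \<subseteq> E \<union> {z. poly (Polynomial.smult (u i1) ?a - Polynomial.smult (u i0) ?b) z = 0}"
        using over_root by blast
      then show False using fin E(1) infinite_UNIV_char_0[where ?'a = complex] finite_subset by blast
    qed
    then show ?thesis unfolding rational_curve_on_def using f(1) by blast
  qed
  moreover have "proj_pt (?w z) \<in> f ` proj_line" if "z \<notin> E" for z
    using fE[OF that] line[of z] by (metis imageI)
  ultimately show ?thesis using E(1,3) by blast
qed

text \<open>At a generic z, pairwise independent solutions become distinct points over s(z), all on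
  curves with bounded fibres. These curves together have fewer than \<open>R\<close> points over any
  one base point.\<close>

lemma nonconstant_solutions_bounded:
  assumes fin: "finite {C. rational_curve_on X C}"
  shows "\<exists>R :: nat. \<forall>s V. s \<notin> range ratfun_const \<longrightarrow>
     (\<forall>j<R. ratfun_solution (V j) s \<and> (\<forall>i>N. V j i = 0) \<and> (\<exists>i. V j i \<noteq> 0)) \<longrightarrow>
     (\<exists>j<R. \<exists>l<j. \<forall>k\<le>N. \<forall>m\<le>N. V j k * V l m = V j m * V l k)"
proof -
  \<comment> \<open>Components of fibres are rational curves as well, but they have infinitely many
    points over one base point and are left out here.\<close>
  define CC where "CC = {C. rational_curve_on X C \<and> (\<exists>d. bounded_fibres C d)}"
  have finC: "finite CC" unfolding CC_def using fin by (rule rev_finite_subset) blast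
  \<comment> \<open>This bound depends on the curve alone, whereas the one produced in
    \<open>solution_curve\<close> grows with the degrees of s; hence \<open>R\<close> is uniform in
    s.\<close>
  define D where "D C = (SOME d. bounded_fibres C d)" for C
  have D: "bounded_fibres C (D C)" if "C \<in> CC" for C
    using that unfolding CC_def D_def by (auto intro: someI)
  define R where "R = Suc (\<Sum>C\<in>CC. D C)"
  have main: "\<exists>j<R. \<exists>l<j. \<forall>k\<le>N. \<forall>m\<le>N. V j k * V l m = V j m * V l k"
    if nonconst: "s \<notin> range ratfun_const"
      and V: "\<forall>j<R. ratfun_solution (V j) s \<and> (\<forall>i>N. V j i = 0) \<and> (\<exists>i. V j i \<noteq> 0)" for s V
  proof (rule ccontr)
    assume "\<not> ?thesis"
    then have minor: "\<exists>k m. V j k * V l m \<noteq> V j m * V l k" if "j < R" "l < j" for j l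
      using that by blast
    obtain a b where ab: "b \<noteq> 0" "s = to_fract a / to_fract b" using ratfun_cases by blast
    have "\<exists>p. snd p \<noteq> 0 \<and> (\<forall>i>N. fst p i = 0) \<and> (\<forall>i. V j i = to_fract (fst p i) / to_fract (snd p))"
      if j: "j < R" for j
    proof -
      have "\<forall>i>N. V j i = 0" using V j by blast
      then have "\<exists>B W. B \<noteq> 0 \<and> (\<forall>i>N. W i = 0) \<and> (\<forall>i. V j i = to_fract (W i) / to_fract B)"
        by (intro clear_denominators) blast
      then obtain B W where "B \<noteq> 0 \<and> (\<forall>i>N. W i = 0) \<and> (\<forall>i. V j i = to_fract (W i) / to_fract B)"
        by (elim exE)
      then show ?thesis by (intro exI[of _ "(W, B)"]) simp
    qed
    then have "\<forall>j\<in>{..<R}. \<exists>p. snd p \<noteq> 0 \<and> (\<forall>i>N. fst p i = 0) \<and>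
        (\<forall>i. V j i = to_fract (fst p i) / to_fract (snd p))" by blast
    then obtain p where p: "\<forall>j\<in>{..<R}. snd (p j) \<noteq> 0 \<and> (\<forall>i>N. fst (p j) i = 0) \<and>
        (\<forall>i. V j i = to_fract (fst (p j) i) / to_fract (snd (p j)))"
      by (rule bchoice[THEN exE])
    define W where "W j = fst (p j)" for j
    define B where "B j = snd (p j)" for j
    have WB: "B j \<noteq> 0" "\<forall>i>N. W j i = 0" "V j i = to_fract (W j i) / to_fract (B j)"
      if "j < R" for i j using p that unfolding W_def B_def by auto
    let ?P = "\<lambda>z j. proj_pt (\<lambda>i. rat_poly_eval (W j i) z)"
    have "\<exists>E. finite E \<and> (\<forall>z. z \<notin> E \<longrightarrow>
        (\<exists>C\<in>CC. ?P z j \<in> C) \<and> over (?P z j) (rat_poly_eval a z) (rat_poly_eval b z))"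
      if j: "j < R" for j
    proof -
      obtain i where "V j i \<noteq> 0" using V j by blast
      then have Wi: "W j i \<noteq> 0" using WB(3)[OF j, of i] by auto
      have sol: "ratfun_solution (V j) s" using V j by blast
      obtain C d E where C: "rational_curve_on X C" "bounded_fibres C d" and E: "finite E"
        "\<forall>z. z \<notin> E \<longrightarrow> ?P z j \<in> C \<and> over (?P z j) (rat_poly_eval a z) (rat_poly_eval b z)"
        using solution_curve[OF sol WB(1)[OF j] ab(1) WB(2)[OF j] WB(3)[OF j] ab(2) Wi nonconst]
        by (elim exE conjE) (rule that; assumption)
      have "C \<in> CC" unfolding CC_def using C by blast
      with E show ?thesis by (intro exI[of _ E]) blast
    qed
    then have "\<forall>j\<in>{..<R}. \<exists>E. finite E \<and> (\<forall>z. z \<notin> E \<longrightarrow>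
        (\<exists>C\<in>CC. ?P z j \<in> C) \<and> over (?P z j) (rat_poly_eval a z) (rat_poly_eval b z))" by blast
    then obtain E where E: "\<forall>j\<in>{..<R}. finite (E j) \<and> (\<forall>z. z \<notin> E j \<longrightarrow>
        (\<exists>C\<in>CC. ?P z j \<in> C) \<and> over (?P z j) (rat_poly_eval a z) (rat_poly_eval b z))"
      by (rule bchoice[THEN exE])
    \<comment> \<open>A minor that is nonzero over \<open>\<rat>(z)\<close> gives a nonzero
      polynomial, and two of the points can coincide only at its roots.\<close>
    have "\<exists>M. finite M \<and> (\<forall>z. z \<notin> M \<longrightarrow> ?P z j \<noteq> ?P z l)" if jl: "j < R" "l < j" for j l
    proof -
      obtain k m where km: "V j k * V l m \<noteq> V j m * V l k" using minor[OF jl] by blast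
      have "l < R" using jl by simp
      have Vm: "V j k * V l m = to_fract (W j k * W l m) / (to_fract (B j) * to_fract (B l))" for k m
        using WB(3)[OF jl(1), of k] WB(3)[OF \<open>l < R\<close>, of m] by simp
      have "W j k * W l m \<noteq> W l k * W j m"
      proof
        assume "W j k * W l m = W l k * W j m"
        then have "W j k * W l m = W j m * W l k" by (simp only: mult.commute)
        then show False using km unfolding Vm by simp
      qed
      then have "W j k * W l m - W j m * W l k \<noteq> 0" by (simp add: mult.commute)
      then have fin: "finite {z. rat_poly_eval (W j k * W l m - W j m * W l k) z = 0}"
        by (rule finite_rat_poly_eval_roots)
      have "?P z j \<noteq> ?P z l"
        if "z \<notin> {z. rat_poly_eval (W j k * W l m - W j m * W l k) z = 0}" for z
        using that minor_eq_if_proj_pt_eq[of "\<lambda>i. rat_poly_eval (W j i) z"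
            "\<lambda>i. rat_poly_eval (W l i) z" k m]
        by (auto simp: rat_poly_eval_diff rat_poly_eval_mult)
      then show ?thesis
        by (intro exI[of _ "{z. rat_poly_eval (W j k * W l m - W j m * W l k) z = 0}"]
            conjI allI impI fin)
    qed
    then have "\<forall>q\<in>Sigma {..<R} (\<lambda>j. {..<j}). \<exists>M. finite M \<and>
        (\<forall>z. z \<notin> M \<longrightarrow> ?P z (fst q) \<noteq> ?P z (snd q))" by auto
    then obtain M where M: "\<forall>q\<in>Sigma {..<R} (\<lambda>j. {..<j}). finite (M q) \<and>
        (\<forall>z. z \<notin> M q \<longrightarrow> ?P z (fst q) \<noteq> ?P z (snd q))"
      by (rule bchoice[THEN exE])
    \<comment> \<open>Outside \<open>bad\<close> all points lie on curves of \<open>CC\<close> over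
      the same base value, no two coincide, and b(z) \<noteq> 0 makes that value a genuine point of
      the line.\<close>
    define bad where "bad = (\<Union>j\<in>{..<R}. E j) \<union> (\<Union>q\<in>Sigma {..<R} (\<lambda>j. {..<j}). M q) \<union>
      {z. rat_poly_eval b z = 0}"
    have "finite bad"
      unfolding bad_def
    proof (intro finite_UnI finite_UN_I finite_SigmaI)
      show "finite (E j)" if "j \<in> {..<R}" for j using bspec[OF E that] by (rule conjunct1)
      show "finite (M q)" if "q \<in> Sigma {..<R} (\<lambda>j. {..<j})" for q
        using bspec[OF M that] by (rule conjunct1)
      show "finite {z. rat_poly_eval b z = 0}" using ab(1) by (rule finite_rat_poly_eval_roots)
    qed auto
    then have "\<exists>z. z \<notin> bad" by (rule ex_new_if_finite[OF infinite_UNIV_char_0])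
    then obtain z where z: "z \<notin> bad" ..
    have zE: "z \<notin> E j" if "j \<in> {..<R}" for j using z that unfolding bad_def by (simp add: UN_iff)
    have zM: "z \<notin> M q" if "q \<in> Sigma {..<R} (\<lambda>j. {..<j})" for q
      using z that unfolding bad_def Un_iff UN_iff by blast
    let ?x = "rat_poly_eval a z" and ?y = "rat_poly_eval b z"
    have xy: "(?x, ?y) \<noteq> (0, 0)" using z unfolding bad_def by simp
    have "?P z j \<noteq> ?P z l" if "j < R" "l < j" for j l
    proof -
      have q: "(j, l) \<in> Sigma {..<R} (\<lambda>j. {..<j})" using that by simp
      show ?thesis using bspec[OF M q] zM[OF q] by simp
    qed
    then have "inj_on (?P z) {..<R}"
      by (intro inj_onI) (metis lessThan_iff nat_neq_iff)
    then have cardR: "card (?P z ` {..<R}) = R" by (simp add: card_image)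
    have sub: "?P z ` {..<R} \<subseteq> (\<Union>C\<in>CC. {P \<in> C. over P ?x ?y})"
    proof
      fix P assume "P \<in> ?P z ` {..<R}"
      then obtain j where "j \<in> {..<R}" "P = ?P z j" by blast
      then have "(\<exists>C\<in>CC. P \<in> C) \<and> over P ?x ?y"
        using bspec[OF E \<open>j \<in> {..<R}\<close>] zE by simp
      then show "P \<in> (\<Union>C\<in>CC. {P \<in> C. over P ?x ?y})" by blast
    qed
    have fb: "finite {P \<in> C. over P ?x ?y} \<and> card {P \<in> C. over P ?x ?y} \<le> D C"
      if "C \<in> CC" for C
      using D[OF that, unfolded bounded_fibres_def, rule_format, OF xy] .
    have "finite (\<Union>C\<in>CC. {P \<in> C. over P ?x ?y})"
      using finC conjunct1[OF fb] by (rule finite_UN_I)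
    then have "R \<le> card (\<Union>C\<in>CC. {P \<in> C. over P ?x ?y})"
      using card_mono[OF _ sub] cardR by simp
    also have "\<dots> \<le> (\<Sum>C\<in>CC. card {P \<in> C. over P ?x ?y})" using finC by (rule card_UN_le)
    also have "\<dots> \<le> (\<Sum>C\<in>CC. D C)" by (intro sum_mono conjunct2[OF fb])
    finally show False unfolding R_def by simp
  qed
  show ?thesis
    by (rule exI[of _ R], intro allI impI) (rule main; assumption)
qed

end

section \<open>Rational points on fibres of positive rank\<close>

lemma rational_pointsI:
  assumes "P \<in> X" "v \<in> P" "\<And>i. v i \<in> k"
  shows "P \<in> rational_points k X"
  unfolding rational_points_def by (intro CollectI conjI bexI[of _ v] allI assms)

lemma morphism_rational_points:
  assumes "morphism \<rat> X Y f" "P \<in> rational_points \<rat> X"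
  shows "f P \<in> rational_points \<rat> Y"
proof -
  obtain v where v: "P \<in> X" "v \<in> P" "\<forall>i. v i \<in> \<rat>"
    using assms(2) unfolding rational_points_def by blast
  obtain F where F: "local_rep \<rat> X f P F" using assms(1) v(1) unfolding morphism_def by blast
  obtain G e where G: "\<forall>v\<in>P. mpoly_eval v G \<noteq> 0"
    "\<forall>Q\<in>X. \<forall>v\<in>Q. mpoly_eval v G \<noteq> 0 \<longrightarrow> f Q = proj_pt (\<lambda>i. mpoly_eval v (F i))"
    using F unfolding local_rep_def by blast
  have "f P = proj_pt (\<lambda>i. mpoly_eval v (F i))" using G v by blast
  then have "(\<lambda>i. mpoly_eval v (F i)) \<in> f P" using proj_pt_self by simp
  moreover have "mpoly_eval v (F i) \<in> \<rat>" for i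
  proof (rule mpoly_eval_in_Rats)
    show "has_coeffs_in \<rat> (F i)" using F unfolding local_rep_def by blast
    show "v i \<in> \<rat>" for i using v(3) by blast
  qed
  moreover have "f P \<in> Y" using assms(1) v(1) unfolding morphism_def by blast
  ultimately show ?thesis by (intro rational_pointsI)
qed

lemma segre_rational_points:
  assumes "P \<in> rational_points \<rat> X" "Q \<in> rational_points \<rat> Y"
  shows "segre M P Q \<in> rational_points \<rat> (product_variety M X Y)"
proof -
  obtain v where v: "P \<in> X" "v \<in> P" "\<forall>i. v i \<in> \<rat>"
    using assms(1) unfolding rational_points_def by blast
  obtain w where w: "Q \<in> Y" "w \<in> Q" "\<forall>i. w i \<in> \<rat>"
    using assms(2) unfolding rational_points_def by blast
  have "(\<lambda>l. v (l div (M + 1)) * w (l mod (M + 1))) \<in> segre M P Q"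
    unfolding segre_def using v(2) w(2) by blast
  moreover have "v (l div (M + 1)) * w (l mod (M + 1)) \<in> \<rat>" for l
    using v(3) w(3) by simp
  moreover have "segre M P Q \<in> product_variety M X Y"
    unfolding product_variety_def using v(1) w(1) by blast
  ultimately show ?thesis by (intro rational_pointsI)
qed

text \<open>Addition and inversion are morphisms over \<open>\<rat>\<close>, so the rational points
  form a subgroup.\<close>

lemma comm_group_mordell_weil:
  assumes "elliptic_curve \<rat> N E O\<^sub>E \<mu>"
  shows "comm_group (mordell_weil_group \<rat> N E O\<^sub>E \<mu>)"
proof -
  let ?G = "curve_group N E O\<^sub>E \<mu>" and ?H = "rational_points \<rat> E"
  interpret G: comm_group ?G using assms unfolding elliptic_curve_def by blast
  have "subgroup ?H ?G"
  proof (rule G.subgroupI)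
    show "?H \<subseteq> carrier ?G" by (auto simp: curve_group_def rational_points_def)
    show "?H \<noteq> {}" using assms unfolding elliptic_curve_def by blast
    show "inv\<^bsub>?G\<^esub> P \<in> ?H" if "P \<in> ?H" for P
      using assms that morphism_rational_points unfolding elliptic_curve_def by blast
    show "P \<otimes>\<^bsub>?G\<^esub> Q \<in> ?H" if "P \<in> ?H" "Q \<in> ?H" for P Q
    proof -
      have "morphism \<rat> (product_variety N E E) E \<mu>" using assms unfolding elliptic_curve_def by blast
      then have "\<mu> (segre N P Q) \<in> ?H"
        using segre_rational_points[OF that] by (rule morphism_rational_points)
      then show ?thesis by (simp add: curve_group_def)
    qed
  qed
  then have "group (?G\<lparr>carrier := ?H\<rparr>)" by (rule G.subgroup_imp_group)
  moreover have "P \<otimes>\<^bsub>?G\<lparr>carrier := ?H\<rparr>\<^esub> Q = Q \<otimes>\<^bsub>?G\<lparr>carrier := ?H\<rparr>\<^esub> P"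
    if "P \<in> carrier (?G\<lparr>carrier := ?H\<rparr>)" "Q \<in> carrier (?G\<lparr>carrier := ?H\<rparr>)" for P Q
    using that G.m_comm[of P Q] by (simp add: curve_group_def rational_points_def)
  ultimately show ?thesis
    unfolding mordell_weil_group_def by (rule group.group_comm_groupI)
qed

text \<open>In a finite group the exponent \<open>order G\<close> kills every element, so no element
  belongs to an independent set.\<close>

lemma infinite_carrier_if_abelian_rank_pos:
  assumes "comm_group G" "abelian_rank G > 0"
  shows "infinite (carrier G)"
proof
  assume fin: "finite (carrier G)"
  interpret comm_group G by fact
  obtain S where S: "int_independent G S" "card S > 0"
    using assms(2) unfolding abelian_rank_def less_SUP_iff by (auto simp: zero_enat_def)
  then obtain s where s: "s \<in> S" by fastforce
  have Sc: "S \<subseteq> carrier G" using S(1) unfolding int_independent_def by blast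
  let ?c = "\<lambda>x. if x = s then int (order G) else 0"
  have "x [^]\<^bsub>G\<^esub> ?c x = \<one>\<^bsub>G\<^esub>" if "x \<in> S" for x
    using that Sc pow_order_eq_1[of s] by (auto simp: int_pow_int)
  then have fp: "finprod G (\<lambda>x. x [^]\<^bsub>G\<^esub> ?c x) S = \<one>\<^bsub>G\<^esub>"
    by (rule finprod_one_eqI)
  have ind: "\<forall>c :: _ \<Rightarrow> int. finprod G (\<lambda>x. x [^]\<^bsub>G\<^esub> c x) S = \<one>\<^bsub>G\<^esub> \<longrightarrow> (\<forall>s\<in>S. c s = 0)"
    using S(1) unfolding int_independent_def by blast
  have "\<forall>s\<in>S. ?c s = 0" by (rule ind[THEN spec, of ?c, THEN mp, OF fp])
  then have "order G = 0" using s by auto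
  then show False using fin order_gt_0_iff_finite by simp
qed

lemma infinite_rational_points_if_rank_pos:
  assumes "elliptic_curve \<rat> N E O\<^sub>E \<mu>"
    and "abelian_rank (mordell_weil_group \<rat> N E O\<^sub>E \<mu>) > 0"
  shows "infinite (rational_points \<rat> E)"
  using infinite_carrier_if_abelian_rank_pos[OF comm_group_mordell_weil[OF assms(1)] assms(2)]
  by (simp add: mordell_weil_group_def)

section \<open>Values with many points above them, and the Diophantine definition of the
  constants\<close>

context charted_fibration
begin

text \<open>Any \<open>R\<close> rational points over q have rational coordinate vectors, and these
  are read as constant vectors over \<open>\<rat>(z)\<close>.\<close>

lemma constant_solutions:
  fixes R :: nat
  assumes inf: "infinite (rational_points \<rat> {P \<in> X. over P (of_rat q) 1})"
  shows "\<exists>V. (\<forall>j<R. ratfun_solution (V j) (ratfun_const q) \<and> (\<forall>i>N. V j i = 0) \<and>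
       (\<exists>i. V j i \<noteq> 0)) \<and>
     (\<forall>j<R. \<forall>l<j. \<exists>k\<le>N. \<exists>m\<le>N. V j k * V l m \<noteq> V j m * V l k)"
proof -
  let ?A = "rational_points \<rat> {P \<in> X. over P (of_rat q) 1}"
  obtain T where T: "T \<subseteq> ?A" "finite T" "card T = R"
    using infinite_arbitrarily_large[OF inf] by blast
  obtain p where p: "bij_betw p {0..<R} T" using ex_bij_betw_nat_finite[OF T(2)] T(3) by blast
  have "\<exists>r. (\<lambda>i. of_rat (r i)) \<in> p j" if j: "j < R" for j
  proof -
    have "p j \<in> ?A" using p T(1) j unfolding bij_betw_def by auto
    then obtain v where v: "v \<in> p j" "\<forall>i. v i \<in> \<rat>" unfolding rational_points_def by blast
    have "(\<lambda>i. of_rat (rat_of_complex (v i))) = v" using v(2) by (simp add: of_rat_rat_of_complex)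
    then show ?thesis using v(1) by (intro exI[of _ "\<lambda>i. rat_of_complex (v i)"]) simp
  qed
  then have "\<forall>j\<in>{..<R}. \<exists>r. (\<lambda>i. of_rat (r i)) \<in> p j" by blast
  then obtain r where r: "\<forall>j\<in>{..<R}. (\<lambda>i. of_rat (r j i)) \<in> p j" by (rule bchoice[THEN exE])
  let ?u = "\<lambda>j i. of_rat (r j i) :: complex"
  let ?V = "\<lambda>j i. ratfun_const (r j i)"
  have pX: "p j \<in> X" "over (p j) (of_rat q) 1" if "j < R" for j
  proof -
    have "p j \<in> ?A" using p T(1) that unfolding bij_betw_def by auto
    then show "p j \<in> X" "over (p j) (of_rat q) 1" unfolding rational_points_def by blast+
  qed
  have up: "?u j \<in> p j" if "j < R" for j using bspec[OF r, of j] that by simp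
  have pt: "p j = proj_pt (?u j)" "?u j \<in> cvec N" "\<exists>i. ?u j i \<noteq> 0" if j: "j < R" for j
  proof -
    have "p j \<in> proj_space N" using pX(1)[OF j] X_subset by blast
    note proj_space_mem[OF this up[OF j]]
    then show "p j = proj_pt (?u j)" "?u j \<in> cvec N" "\<exists>i. ?u j i \<noteq> 0" by blast+
  qed
  have sol: "ratfun_solution (?V j) (ratfun_const q)" if j: "j < R" for j
  proof -
    have 1: "ratfun_eval_at (?V j) F = 0" if F: "F \<in> S" for F
    proof -
      obtain i where i: "?u j i \<noteq> 0" using pt(3)[OF j] by blast
      have "mpoly_eval (?u j) F = 0"
        using X_iff[of "?u j" i, OF pt(2)[OF j] i] pX(1)[OF j] pt(1)[OF j] F by simp
      moreover obtain t where "ratfun_eval_at (?V j) F = ratfun_const t"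
        "mpoly_eval (?u j) F = of_rat t"
        using ratfun_eval_at_const[OF S_coeffs[OF F], of "r j"] by blast
      ultimately show ?thesis by simp
    qed
    obtain G H where GH: "(G, H) \<in> K" "mpoly_eval (?u j) G \<noteq> 0"
      using K_cover[OF pX(1)[OF j] up[OF j]] by blast
    note chart = K_chart[OF GH(1), unfolded rational_chart_def]
    obtain t where t: "ratfun_eval_at (?V j) G = ratfun_const t" "mpoly_eval (?u j) G = of_rat t"
      using ratfun_eval_at_const[of G "r j"] chart by blast
    obtain t0 where t0: "ratfun_eval_at (?V j) (H i0) = ratfun_const t0"
      "mpoly_eval (?u j) (H i0) = of_rat t0"
      using ratfun_eval_at_const[of "H i0" "r j"] chart by blast
    obtain t1 where t1: "ratfun_eval_at (?V j) (H i1) = ratfun_const t1"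
      "mpoly_eval (?u j) (H i1) = of_rat t1"
      using ratfun_eval_at_const[of "H i1" "r j"] chart by blast
    have "\<pi> (p j) = proj_pt (\<lambda>i. mpoly_eval (?u j) (H i))"
      using chart pX(1)[OF j] up[OF j] GH(2) by blast
    then have "(\<lambda>i. mpoly_eval (?u j) (H i)) \<in> \<pi> (p j)" using proj_pt_self by simp
    from over_all[OF pX(1)[OF j] pX(2)[OF j] this]
    have "(of_rat t0 :: complex) = of_rat (t1 * q)" unfolding t0(2) t1(2) by (simp add: of_rat_mult)
    then have "t0 = q * t1" by (simp add: mult.commute)
    then have 2: "ratfun_eval_at (?V j) (H i0) = ratfun_const q * ratfun_eval_at (?V j) (H i1)"
      unfolding t0(1) t1(1) by (simp add: ratfun_const_mult)
    have "t \<noteq> 0" using GH(2) t(2) by auto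
    then have "ratfun_eval_at (?V j) G \<noteq> 0" unfolding t(1) using ratfun_const_eq_iff[of t 0] by simp
    then show ?thesis unfolding ratfun_solution_def using 1 2 GH(1)
      by (intro conjI ballI bexI[of _ "(G, H)"]) auto
  qed
  have supp: "\<forall>i>N. ?V j i = 0" if "j < R" for j
    using pt(2)[OF that] unfolding cvec_def by simp
  have nz: "\<exists>i. ?V j i \<noteq> 0" if "j < R" for j
    using pt(3)[OF that] ratfun_const_eq_iff[of _ 0] by auto
  have minor: "\<exists>k\<le>N. \<exists>m\<le>N. ?V j k * ?V l m \<noteq> ?V j m * ?V l k" if jl: "j < R" "l < j" for j l
  proof -
    have l: "l < R" using jl by simp
    have "p j \<noteq> p l" using p jl l unfolding bij_betw_def inj_on_def by (metis atLeastLessThan_iff less_irrefl zero_le)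
    then have ne: "proj_pt (?u j) \<noteq> proj_pt (?u l)" using pt(1)[OF jl(1)] pt(1)[OF l] by simp
    obtain a where a: "?u j a \<noteq> 0" using pt(3)[OF jl(1)] by blast
    obtain b where b: "?u l b \<noteq> 0" using pt(3)[OF l] by blast
    obtain k m where km: "k \<le> N" "m \<le> N" "?u j k * ?u l m \<noteq> ?u j m * ?u l k"
      using proj_pt_inj_minor[of "?u j" "?u l" N a b, OF ne pt(2)[OF jl(1)] pt(2)[OF l] a b] by blast
    then have "r j k * r l m \<noteq> r j m * r l k" by (auto simp: of_rat_mult[symmetric])
    then have "?V j k * ?V l m \<noteq> ?V j m * ?V l k" by (simp add: ratfun_const_mult[symmetric])
    then show ?thesis using km(1,2) by blast
  qed
  show ?thesis
    by (rule exI[of _ ?V]) (use sol supp nz minor in blast)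
qed

text \<open>Distinctness of projective points is stated by nonzero minors, as needed for an
  existential polynomial condition.\<close>

definition many_solutions :: "nat \<Rightarrow> ratfun \<Rightarrow> bool" where
  "many_solutions R s \<longleftrightarrow> (\<exists>V. (\<forall>j<R. ratfun_solution (V j) s \<and> (\<forall>i>N. V j i = 0) \<and>
       (\<exists>i. V j i \<noteq> 0)) \<and>
     (\<forall>j<R. \<forall>l<j. \<exists>k\<le>N. \<exists>m\<le>N. V j k * V l m \<noteq> V j m * V l k))"

lemma dio_many_solutions: "dio (\<lambda>w :: nat \<Rightarrow> ratfun. many_solutions R (w 0))"
proof -
  \<comment> \<open>Through \<open>prod_encode\<close> one witness sequence holds the whole matrix
    \<open>V\<close>; reading 0 beyond \<open>N\<close> enforces the support condition.\<close>
  define row where "row y j i = (if i \<le> N then y (prod_encode (j, i)) else 0)"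
    for y :: "nat \<Rightarrow> ratfun" and j i
  \<comment> \<open>Once y is given, every quantifier ranges over a finite set, so the closure rules
    for \<open>dio\<close> apply.\<close>
  define good where "good s y \<longleftrightarrow> (\<forall>j\<in>{..<R}. ((\<forall>F\<in>S. ratfun_eval_at (row y j) F = 0) \<and>
      (\<exists>p\<in>K. ratfun_eval_at (row y j) (fst p) \<noteq> 0 \<and>
        ratfun_eval_at (row y j) (snd p i0) = s * ratfun_eval_at (row y j) (snd p i1))) \<and>
      (\<exists>i\<in>{..N}. row y j i \<noteq> 0)) \<and>
      (\<forall>j\<in>{..<R}. \<forall>l\<in>{..<j}. \<exists>k\<in>{..N}. \<exists>m\<in>{..N}.
        row y j k * row y l m \<noteq> row y j m * row y l k)" for s and y :: "nat \<Rightarrow> ratfun"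
  have sol_iff: "ratfun_solution v s \<longleftrightarrow> (\<forall>F\<in>S. ratfun_eval_at v F = 0) \<and>
      (\<exists>p\<in>K. ratfun_eval_at v (fst p) \<noteq> 0 \<and>
        ratfun_eval_at v (snd p i0) = s * ratfun_eval_at v (snd p i1))" for v s
    unfolding ratfun_solution_def case_prod_beta ..
  have nz_iff: "(\<exists>i\<in>{..N}. row y j i \<noteq> 0) \<longleftrightarrow> (\<exists>i. row y j i \<noteq> 0)" for y j
    unfolding row_def by auto
  have "many_solutions R s \<longleftrightarrow> (\<exists>y. good s y)" for s
  proof
    assume "many_solutions R s"
    then obtain V where V: "\<forall>j<R. ratfun_solution (V j) s \<and> (\<forall>i>N. V j i = 0) \<and> (\<exists>i. V j i \<noteq> 0)"
      "\<forall>j<R. \<forall>l<j. \<exists>k\<le>N. \<exists>m\<le>N. V j k * V l m \<noteq> V j m * V l k"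
      unfolding many_solutions_def by (elim exE conjE)
    define y where "y c = (case prod_decode c of (j, i) \<Rightarrow> V j i)" for c
    have row: "row y j = V j" if "j < R" for j
      using V(1) that unfolding row_def y_def by (auto simp: fun_eq_iff)
    have "good s y"
      unfolding good_def nz_iff sol_iff[symmetric]
    proof (intro conjI ballI)
      fix j assume "j \<in> {..<R}"
      then have j: "j < R" by simp
      show "ratfun_solution (row y j) s" "\<exists>i. row y j i \<noteq> 0"
        unfolding row[OF j] using V(1) j by blast+
      fix l assume "l \<in> {..<j}"
      then have l: "l < j" "l < R" using j by auto
      show "\<exists>k\<in>{..N}. \<exists>m\<in>{..N}. row y j k * row y l m \<noteq> row y j m * row y l k"
        unfolding row[OF j] row[OF l(2)] using V(2) j l(1) by (simp add: Bex_def)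
    qed
    then show "\<exists>y. good s y" by (rule exI[of "good s" y])
  next
    assume "\<exists>y. good s y"
    then obtain y where y: "good s y" by (elim exE)
    have "\<forall>i>N. row y j i = 0" for j unfolding row_def by simp
    then show "many_solutions R s"
      using y unfolding many_solutions_def good_def nz_iff sol_iff[symmetric]
      by (intro exI[of _ "row y"]) (simp add: Bex_def)
  qed
  moreover have "dio (\<lambda>w :: nat \<Rightarrow> ratfun. \<exists>y. good (w 0) y)"
  proof (rule dio_ex)
    have row: "polyfun (\<lambda>u :: nat + nat \<Rightarrow> ratfun. row (\<lambda>i. u (Inr i)) j i)" for j i
      unfolding row_def by (cases "i \<le> N") (simp_all add: polyfun.var polyfun.const)
    have ev: "polyfun (\<lambda>u :: nat + nat \<Rightarrow> ratfun. ratfun_eval_at (row (\<lambda>i. u (Inr i)) j) F)" for j F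
      using polyfun_coeff_eval[of "\<lambda>i u. row (\<lambda>i. u (Inr i)) j i", OF row]
      unfolding ratfun_eval_at_def .
    show "dio (\<lambda>u :: nat + nat \<Rightarrow> ratfun. good (u (Inl 0)) (\<lambda>i. u (Inr i)))"
      unfolding good_def
      by (intro dio_conj dio_ball dio_bex dio_neq dio_eq dio_eq_0 ev row polyfun.mult polyfun.var
          polyfun.const finite_lessThan finite_atMost S_finite K_finite)
  qed
  ultimately show ?thesis by simp
qed

lemma diophantine_rat_constants:
  assumes fin: "finite {C. rational_curve_on X C}" and "c > 0"
    and dens: "\<forall>\<^sub>F x :: real in at_top. real (card {n :: nat. 1 \<le> n \<and> real n \<le> x \<and> good n}) \<ge> c * x"
    and good: "\<And>n. good n \<Longrightarrow> infinite (rational_points \<rat> {P \<in> X. over P (of_nat n) 1})"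
  shows "diophantine 1 rat_constants"
proof -
  obtain R :: nat where R: "\<forall>s V. s \<notin> range ratfun_const \<longrightarrow>
     (\<forall>j<R. ratfun_solution (V j) s \<and> (\<forall>i>N. V j i = 0) \<and> (\<exists>i. V j i \<noteq> 0)) \<longrightarrow>
     (\<exists>j<R. \<exists>l<j. \<forall>k\<le>N. \<forall>m\<le>N. V j k * V l m = V j m * V l k)"
    using nonconstant_solutions_bounded[OF fin] by (rule exE)
  let ?D = "many_solutions R"
  have D_const: "s \<in> range ratfun_const" if "?D s" for s
  proof (rule ccontr)
    assume s: "s \<notin> range ratfun_const"
    obtain V where V: "\<forall>j<R. ratfun_solution (V j) s \<and> (\<forall>i>N. V j i = 0) \<and> (\<exists>i. V j i \<noteq> 0)"
      "\<forall>j<R. \<forall>l<j. \<exists>k\<le>N. \<exists>m\<le>N. V j k * V l m \<noteq> V j m * V l k"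
      using \<open>?D s\<close> unfolding many_solutions_def by (elim exE conjE)
    have "\<exists>j<R. \<exists>l<j. \<forall>k\<le>N. \<forall>m\<le>N. V j k * V l m = V j m * V l k"
      using R[rule_format, OF s] V(1) by blast
    then show False using V(2) by blast
  qed
  have D_good: "?D (ratfun_const (of_nat n))" if "good n" for n
    unfolding many_solutions_def
    by (rule constant_solutions) (use good[OF that] in simp)
  define Q where "Q x \<longleftrightarrow> (\<exists>y :: nat \<Rightarrow> ratfun. ?D (y 0) \<and> ?D (y 1) \<and> ?D (y 2) \<and> ?D (y 3) \<and>
     y 2 \<noteq> y 3 \<and> x * (y 2 - y 3) = y 0 - y 1)" for x
  have dioD: "dio (\<lambda>w. ?D (f w))" if "polyfun f" for f :: "(nat + nat \<Rightarrow> ratfun) \<Rightarrow> ratfun"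
    using dio_subst[OF dio_many_solutions, of "\<lambda>_. f"] that by simp
  have "dio (\<lambda>w :: nat \<Rightarrow> ratfun. Q (w 0))"
    unfolding Q_def
    by (rule dio_ex) (intro dio_conj dioD dio_neq dio_eq polyfun.mult polyfun.var polyfun_diff)
  then have "diophantine 1 {[x] | x. Q x}" by (rule diophantine_if_dio)
  moreover have "Q x \<longleftrightarrow> x \<in> range ratfun_const" for x
  proof
    assume "Q x"
    then obtain y :: "nat \<Rightarrow> ratfun" where y: "?D (y 0)" "?D (y 1)" "?D (y 2)" "?D (y 3)"
      "y 2 \<noteq> y 3" "x * (y 2 - y 3) = y 0 - y 1" unfolding Q_def by (elim exE conjE)
    obtain a where a: "y 0 = ratfun_const a" using D_const[OF y(1)] by blast
    obtain b where b: "y 1 = ratfun_const b" using D_const[OF y(2)] by blast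
    obtain d where d: "y 2 = ratfun_const d" using D_const[OF y(3)] by blast
    obtain e where e: "y 3 = ratfun_const e" using D_const[OF y(4)] by blast
    have de: "d - e \<noteq> 0" using y(5) d e by auto
    have "x * ratfun_const (d - e) = ratfun_const ((a - b) / (d - e) * (d - e))"
      using y(6) de unfolding a b d e by (simp add: ratfun_const_diff)
    then have "x * ratfun_const (d - e) = ratfun_const ((a - b) / (d - e)) * ratfun_const (d - e)"
      by (simp only: ratfun_const_mult)
    moreover have "ratfun_const (d - e) \<noteq> 0" using de ratfun_const_eq_iff[of "d - e" 0] by simp
    ultimately show "x \<in> range ratfun_const" by simp
  next
    assume "x \<in> range ratfun_const"
    then obtain q where q: "x = ratfun_const q" by blast
    \<comment> \<open>With q = p / m, the pigeonhole relation m (a - a') = p (b - b') says that q (b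
      - b') = a - a'.\<close>
    obtain p m where pm: "q = Rat.Fract p m" "m > 0" by (cases q) auto
    have "{n \<in> Collect good. 1 \<le> n \<and> real n \<le> t} = {n. 1 \<le> n \<and> real n \<le> t \<and> good n}" for t
      by auto
    then have "\<exists>a\<in>Collect good. \<exists>a'\<in>Collect good. \<exists>b\<in>Collect good. \<exists>b'\<in>Collect good.
        b \<noteq> b' \<and> m * (int a - int a') = p * (int b - int b')"
      using dens pm(2)
      by (intro differences_proportional_if_positive_density[OF \<open>c > 0\<close>]) auto
    then obtain a a' b b' where ab: "good a" "good a'" "good b" "good b'" "b \<noteq> b'"
      "m * (int a - int a') = p * (int b - int b')" by blast
    have eq: "of_int m * (of_nat a - of_nat a') = (of_int p * (of_nat b - of_nat b') :: rat)"
      using arg_cong[OF ab(6), of "of_int :: int \<Rightarrow> rat"] by simp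
    have "q * (of_nat b - of_nat b') = of_int p * (of_nat b - of_nat b') / of_int m"
      unfolding pm(1) by (simp add: Fract_of_int_quotient)
    also have "\<dots> = of_nat a - of_nat a'" unfolding eq[symmetric] using pm(2) by simp
    finally have "q * (of_nat b - of_nat b') = of_nat a - of_nat a'" .
    then have "x * (ratfun_const (of_nat b) - ratfun_const (of_nat b')) =
        ratfun_const (of_nat a) - ratfun_const (of_nat a')"
      unfolding q ratfun_const_diff[symmetric] ratfun_const_mult[symmetric] by simp
    then show "Q x"
      unfolding Q_def using D_good ab(1-5)
      by (intro exI[of _ "(!) [ratfun_const (of_nat a), ratfun_const (of_nat a'),
            ratfun_const (of_nat b), ratfun_const (of_nat b')]"])
        (simp add: numeral_2_eq_2 numeral_3_eq_3)
  qed
  moreover have "rat_constants = {[x] | x. x \<in> range ratfun_const}"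
    unfolding rat_constants_def ratfun_const_def to_fract_def by auto
  ultimately show ?thesis by simp
qed

end

section \<open>Choice of the surface and of the affine coordinate\<close>

theorem theorem8p2:
  assumes "conjecture_A" and "conjecture_C"
  shows "diophantine 1 rat_constants"
proof -
  obtain N X \<pi> \<sigma> b where es: "elliptic_surface N X \<pi> \<sigma>"
    and b: "b \<in> proj_line" "multiplicative_fibre N X \<pi> b"
    and fin: "finite {C. rational_curve_on X C}"
    using assms(2) unfolding conjecture_C_def by blast
  have X: "proj_closed \<rat> N X" and pi: "morphism \<rat> X proj_line \<pi>"
    using es unfolding elliptic_surface_def smooth_projective_variety_def by blast+
  obtain S where S: "finite S" "\<forall>F\<in>S. has_coeffs_in \<rat> F \<and> (\<exists>d. homogeneous d F)"
    "X \<subseteq> proj_space N" "\<forall>u i. u \<in> cvec N \<longrightarrow> u i \<noteq> 0 \<longrightarrow>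
      (proj_pt u \<in> X \<longleftrightarrow> (\<forall>F\<in>S. mpoly_eval u F = 0))"
    using proj_closed_equations[OF X] by (elim exE conjE) (rule that; assumption)
  obtain K where K: "finite K" "\<forall>(G, F)\<in>K. rational_chart X \<pi> G F"
    "\<forall>P\<in>X. \<forall>v\<in>P. \<exists>(G, F)\<in>K. mpoly_eval v G \<noteq> 0"
    using finite_rational_charts[OF X pi] by (elim exE conjE)
  \<comment> \<open>The multiplicative fibre may lie over infinity. Either the identity matrix or
    the swap of the two coordinates brings it into the affine chart, at a possibly irrational t;
    \<open>i0\<close> is the coordinate that equals t and \<open>i1\<close> the one that equals
    1.\<close>
  have "\<exists>\<alpha> \<beta> \<gamma> \<delta> i0 i1. \<alpha> \<in> \<rat> \<and> \<beta> \<in> \<rat> \<and> \<gamma> \<in> \<rat> \<and> \<delta> \<in> \<rat> \<and> \<alpha> * \<delta> - \<beta> * \<gamma> \<noteq> 0 \<and>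
     ((i0::nat) = 0 \<and> (i1::nat) = 1 \<or> i0 = 1 \<and> i1 = 0) \<and>
     (\<exists>t. b = line_pt (\<alpha> * t + \<beta>) (\<gamma> * t + \<delta>)) \<and>
     (\<forall>t. (if i0 = 0 then \<alpha> * t + \<beta> else \<gamma> * t + \<delta>) = t \<and>
          (if i1 = 0 then \<alpha> * t + \<beta> else \<gamma> * t + \<delta>) = 1)"
    using b(1)
  proof (rule proj_line_cases)
    fix z assume bz: "b = line_pt z 1"
    show ?thesis
      by (rule exI[of _ 1], rule exI[of _ 0], rule exI[of _ 0], rule exI[of _ 1],
        rule exI[of _ 0], rule exI[of _ 1]) (use bz in \<open>auto intro: exI[of _ z]\<close>)
  next
    assume bz: "b = line_pt 1 0"
    show ?thesis
      by (rule exI[of _ 0], rule exI[of _ 1], rule exI[of _ 1], rule exI[of _ 0],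
        rule exI[of _ 1], rule exI[of _ 0]) (use bz in \<open>auto intro: exI[of _ 0]\<close>)
  qed
  then obtain \<alpha> \<beta> \<gamma> \<delta> i0 i1 t where chart: "\<alpha> \<in> \<rat>" "\<beta> \<in> \<rat>" "\<gamma> \<in> \<rat>" "\<delta> \<in> \<rat>" "\<alpha> * \<delta> - \<beta> * \<gamma> \<noteq> 0"
    and idx: "(i0 :: nat) = 0 \<and> (i1 :: nat) = 1 \<or> i0 = 1 \<and> i1 = 0"
    and bt: "b = line_pt (\<alpha> * t + \<beta>) (\<gamma> * t + \<delta>)"
    and coord: "\<forall>t. (if i0 = 0 then \<alpha> * t + \<beta> else \<gamma> * t + \<delta>) = t \<and>
          (if i1 = 0 then \<alpha> * t + \<beta> else \<gamma> * t + \<delta>) = 1"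
    by (elim exE conjE)
  let ?pt = "\<lambda>t. line_pt (\<alpha> * t + \<beta>) (\<gamma> * t + \<delta>)"
  interpret charted_fibration N X \<pi> S K i0 i1
  proof
    show "\<pi> P \<in> proj_line" if "P \<in> X" for P using pi that unfolding morphism_def by blast
    show "\<exists>G H. (G, H) \<in> K \<and> mpoly_eval u G \<noteq> 0" if "P \<in> X" "u \<in> P" for P u
      using K(3) that by fast
    show "rational_chart X \<pi> G H" if "(G, H) \<in> K" for G H using K(2) that by fast
    show "proj_pt u \<in> X \<longleftrightarrow> (\<forall>F\<in>S. mpoly_eval u F = 0)" if "u \<in> cvec N" "u i \<noteq> 0" for u i
      by (rule S(4)[rule_format, of u i, OF that])
  qed (use X S K(1) idx in auto)
  define good where "good n \<longleftrightarrow> (\<exists>\<mu>. elliptic_fibre \<rat> N X \<pi> \<sigma> (?pt (of_nat n)) \<mu> \<and>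
      abelian_rank (mordell_weil_group \<rat> N (fibre X \<pi> (?pt (of_nat n))) (\<sigma> (?pt (of_nat n))) \<mu>) > 0)"
    for n :: nat
  have "\<exists>c>0. \<forall>\<^sub>F x :: real in at_top. real (card {n :: nat. 1 \<le> n \<and> real n \<le> x \<and> good n}) \<ge> c * x"
    using assms(1)[unfolded conjecture_A_def Let_def, rule_format, OF es chart] b(2)
    unfolding bt good_def by blast
  then obtain c where c: "c > 0"
    "\<forall>\<^sub>F x :: real in at_top. real (card {n :: nat. 1 \<le> n \<and> real n \<le> x \<and> good n}) \<ge> c * x"
    by (elim exE conjE)
  have "infinite (rational_points \<rat> {P \<in> X. over P (of_nat n) 1})" if n: "good n" for n
  proof -
    obtain \<mu> where "elliptic_curve \<rat> N (fibre X \<pi> (?pt (of_nat n))) (\<sigma> (?pt (of_nat n))) \<mu>"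
      "abelian_rank (mordell_weil_group \<rat> N (fibre X \<pi> (?pt (of_nat n))) (\<sigma> (?pt (of_nat n))) \<mu>) > 0"
      using n unfolding good_def elliptic_fibre_def by blast
    then have inf: "infinite (rational_points \<rat> (fibre X \<pi> (?pt (of_nat n))))"
      by (rule infinite_rational_points_if_rank_pos)
    have "over P (of_nat n) 1" if "\<pi> P = ?pt (of_nat n)" for P
    proof -
      let ?u = "\<lambda>i. if i = 0 then \<alpha> * of_nat n + \<beta> else if i = 1 then \<gamma> * of_nat n + \<delta> else 0"
      have "?u \<in> \<pi> P" unfolding that line_pt_def by (rule proj_pt_self)
      moreover have "?u i0 * 1 = ?u i1 * of_nat n"
        using coord[rule_format, of "of_nat n"] idx by auto
      ultimately show ?thesis unfolding over_def by (intro bexI[of _ ?u])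
    qed
    then have "rational_points \<rat> (fibre X \<pi> (?pt (of_nat n))) \<subseteq>
        rational_points \<rat> {P \<in> X. over P (of_nat n) 1}"
      unfolding rational_points_def fibre_def by blast
    then show ?thesis using inf finite_subset by blast
  qed
  then show ?thesis by (rule diophantine_rat_constants[OF fin c])
qed

end
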